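(* Let $F:[0,T]\times X\to\mathbb{R}$ satisfy (F0)–(F3), and assume that $\nabla_x F(t,0)=0$ for all $t\in[0,T]$. Let $A(t):=\nabla_x^2F(t,0)$, let $\lambda_1(t)$ be the minimum eigenvalue of $A(t)$, assume that $\lambda_1(0)>0$ and $\int_0^T\lambda_1(s)\,\mathrm{d}s<0$, and define $$t^*:=\min\left\{t\in(0,T):\ \int_0^t\lambda_1(s)\,\mathrm{d}s=0\right\}.$$ Assume moreover: (A1) there exists $\rho>0$ such that $\lambda_1(t)$ is a simple eigenvalue of $A(t)$ for all $t\in[0,t^*+\rho]\subset[0,T]$ and its eigenspace is a fixed line $L=\mathrm{span}(e_1)$ independent of $t\in[0,t^*+\rho]$; (A2) $\det(A(t^* ))\neq0$. Let $(u_\varepsilon)_\varepsilon$ be a sequence of solutions to $\varepsilon\dot u_\varepsilon(t)=-\nabla_xF(t,u_\varepsilon(t))$ on $[0,T]$ such that $$\lim_{\varepsilon\to0}u_\varepsilon(0)=0,\qquad \liminf_{\varepsilon\to0}\frac{\|u_\varepsilon(0)\|}{\varepsilon^\alpha}>0\ \text{ for some }\alpha>0,\qquad \liminf_{\varepsilon\to0}\frac{|\langle u_\varepsilon(0),e_1\rangle|^2}{\|u_\varepsilon(0)\|^2}>0 .$$ Let $u:[0,T]\to X$ be the pointwise limit of (a subsequence of) $(u_\varepsilon)_\varepsilon$ provided by the compactness theorem recalled in the context, and let $J$ be its jump set. Then $t^*$ is the minimal element of $J$.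
   Context: $T>0$ is fixed and $(X,\|\cdot\|)$ is an $n$-dimensional real Hilbert space, $n\ge1$, with scalar product $\langle\cdot,\cdot\rangle$. $\nabla_xF$ and $\nabla_x^2F$ denote the gradient and Hessian of $F(t,x)$ with respect to $x$; $\partial_tF$ is the partial derivative in $t$. The parameter $\varepsilon>0$ ranges over a sequence converging to $0$; solutions $u_\varepsilon:[0,T]\to X$ satisfy the equation for a.e. $t\in[0,T]$ (being absolutely continuous, hence $C^1$ and for all $t$). Assumptions: (F0) $F\in C^2([0,T]\times X)$. (F1) With $\mathcal{F}(u):=\sup_{t\in[0,T]}|F(t,u)|$, for every $\rho>0$ the set $\{u\in X:\mathcal{F}(u)\le\rho\}$ is bounded. (F2) There exist $C_1,C_2>0$ such that $|\partial_tF(t,u)|\le C_1F(t,u)+C_2$ for all $(t,u)\in[0,T]\times X$. (F3) For every $t\in[0,T]$ the set of critical points $C(t):=\{u\in X:\nabla_xF(t,u)=0\}$ consists of isolated points. Compactness theorem (Agostiniani–Rossi): under (F0)–(F3), along a subsequence independent of $t$, the solutions $u_\varepsilon$ converge pointwise on $[0,T]$ as $\varepsilon\to0$ to a function $u:[0,T]\to X$ such that: (i) the jump set $J$ of $u$ (its set of discontinuity points) is at most countable; (ii) $u$ is continuous on $[0,T]\setminus J$ and $\nabla_xF(t,u(t))=0$ for every $t\in[0,T]\setminus J$; (iii) the left and right limits $u_-(t)$, $u_+(t)$ exist at every $t\in(0,T)$, and so do $u_+(0)$ and $u_-(T)$. *)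

theory Defs
  imports "HOL-Analysis.Analysis"
begin

text \<open>
  The derivatives are taken within \<open>S\<close>, so on \<open>{0..T} \<times> UNIV\<close> the time derivatives at
  \<open>0\<close> and \<open>T\<close> are one-sided. For \<open>T > 0\<close> derivatives within this set are unique.
\<close>

definition C2_on :: "'b::real_normed_vector set \<Rightarrow> ('b \<Rightarrow> 'c::real_normed_vector) \<Rightarrow> bool" where
  "C2_on S f \<longleftrightarrow>
    (\<exists>(f' :: 'b \<Rightarrow> 'b \<Rightarrow>\<^sub>L 'c) (f'' :: 'b \<Rightarrow> 'b \<Rightarrow>\<^sub>L 'b \<Rightarrow>\<^sub>L 'c).
      (\<forall>z\<in>S. (f has_derivative blinfun_apply (f' z)) (at z within S)) \<and>
      (\<forall>z\<in>S. (f' has_derivative blinfun_apply (f'' z)) (at z within S)) \<and>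
      continuous_on S f'')"

definition gradient :: "('a::euclidean_space \<Rightarrow> real) \<Rightarrow> 'a \<Rightarrow> 'a" where
  "gradient f x = (THE D. GDERIV f x :> D)"

text \<open>The Hessian as a linear operator, i.e. the derivative of the gradient field.\<close>

definition hessian :: "('a::euclidean_space \<Rightarrow> real) \<Rightarrow> 'a \<Rightarrow> 'a \<Rightarrow> 'a" where
  "hessian f x = frechet_derivative (gradient f) (at x)"

definition eigenspace :: "('a::real_vector \<Rightarrow> 'a) \<Rightarrow> real \<Rightarrow> 'a set" where
  "eigenspace A c = {v. A v = c *\<^sub>R v}"

definition eigenvalue :: "('a::real_vector \<Rightarrow> 'a) \<Rightarrow> real \<Rightarrow> bool" where
  "eigenvalue A c \<longleftrightarrow> (\<exists>v. v \<noteq> 0 \<and> A v = c *\<^sub>R v)"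

definition min_eigenvalue :: "('a::real_vector \<Rightarrow> 'a) \<Rightarrow> real" where
  "min_eigenvalue A = (LEAST c. eigenvalue A c)"

text \<open>
  Only used for Hessians, which are self-adjoint, so that geometric and algebraic
  multiplicity agree.
\<close>

definition simple_eigenvalue :: "('a::euclidean_space \<Rightarrow> 'a) \<Rightarrow> real \<Rightarrow> bool" where
  "simple_eigenvalue A c \<longleftrightarrow> eigenvalue A c \<and> dim (eigenspace A c) = 1"

text \<open>
  The library determinant is restricted to matrices with a type as index set. This is the same
  Leibniz formula, for the matrix of \<open>A\<close> in the orthonormal basis \<open>Basis\<close>, whose \<open>(i, j)\<close> entry
  is \<open>A j \<bullet> i\<close>.
\<close>

definition det_op :: "('a::euclidean_space \<Rightarrow> 'a) \<Rightarrow> real" where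
  "det_op A = (\<Sum>p | p permutes (Basis :: 'a set).
                 of_int (sign p) * (\<Prod>i\<in>Basis. A (p i) \<bullet> i))"

text \<open>
  Energies are total functions of \<open>(t, x)\<close>; everything below only depends on their values for
  \<open>t \<in> {0..T}\<close>.
\<close>

definition F0 :: "real \<Rightarrow> (real \<Rightarrow> 'a::euclidean_space \<Rightarrow> real) \<Rightarrow> bool" where
  "F0 T F \<longleftrightarrow> C2_on ({0..T} \<times> UNIV) (\<lambda>(t, x). F t x)"

definition F1 :: "real \<Rightarrow> (real \<Rightarrow> 'a::euclidean_space \<Rightarrow> real) \<Rightarrow> bool" where
  "F1 T F \<longleftrightarrow> (\<forall>\<rho>>0. bounded {x. (SUP t\<in>{0..T}. \<bar>F t x\<bar>) \<le> \<rho>})"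

definition F2 :: "real \<Rightarrow> (real \<Rightarrow> 'a::euclidean_space \<Rightarrow> real) \<Rightarrow> bool" where
  "F2 T F \<longleftrightarrow> (\<exists>C1>0. \<exists>C2>0. \<forall>t\<in>{0..T}. \<forall>x.
     \<bar>vector_derivative (\<lambda>s. F s x) (at t within {0..T})\<bar> \<le> C1 * F t x + C2)"

definition F3 :: "real \<Rightarrow> (real \<Rightarrow> 'a::euclidean_space \<Rightarrow> real) \<Rightarrow> bool" where
  "F3 T F \<longleftrightarrow> (\<forall>t\<in>{0..T}. discrete {x. gradient (F t) x = 0})"

definition is_solution ::
    "real \<Rightarrow> (real \<Rightarrow> 'a::euclidean_space \<Rightarrow> real) \<Rightarrow> real \<Rightarrow> (real \<Rightarrow> 'a) \<Rightarrow> bool" where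
  "is_solution T F \<epsilon> u \<longleftrightarrow>
     (\<forall>t\<in>{0..T}. \<exists>v. (u has_vector_derivative v) (at t within {0..T}) \<and>
        \<epsilon> *\<^sub>R v = - gradient (F t) (u t))"

definition jump_set :: "real \<Rightarrow> (real \<Rightarrow> 'a::euclidean_space) \<Rightarrow> real set" where
  "jump_set T u = {t\<in>{0..T}. \<not> continuous (at t within {0..T}) u}"

text \<open>
  The properties of the limit function in the Agostiniani--Rossi compactness theorem, the last
  four clauses being the existence of the one-sided limits.
\<close>

definition limit_evolution ::
    "real \<Rightarrow> (real \<Rightarrow> 'a::euclidean_space \<Rightarrow> real) \<Rightarrow> (real \<Rightarrow> 'a) \<Rightarrow> bool" where
  "limit_evolution T F u \<longleftrightarrow>
     countable (jump_set T u) \<and>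
     continuous_on ({0..T} - jump_set T u) u \<and>
     (\<forall>t\<in>{0..T} - jump_set T u. gradient (F t) (u t) = 0) \<and>
     (\<forall>t\<in>{0<..<T}. \<exists>l. (u \<longlongrightarrow> l) (at_left t)) \<and>
     (\<forall>t\<in>{0<..<T}. \<exists>l. (u \<longlongrightarrow> l) (at_right t)) \<and>
     (\<exists>l. (u \<longlongrightarrow> l) (at_right 0)) \<and>
     (\<exists>l. (u \<longlongrightarrow> l) (at_left T))"

end

theory Submission
  imports Defs "HOL-Real_Asymp.Real_Asymp"
begin

text \<open>
  Near \<open>0\<close> the flow is governed by the Hessian, so \<open>\<bar>u\<^sub>\<epsilon>(t)\<bar>\<close> is at most about
  \<open>\<bar>u\<^sub>\<epsilon>(0)\<bar> exp (- (1 / \<epsilon>) \<integral>\<^sub>0\<^sup>t \<lambda>\<^sub>1)\<close>. Before \<open>t\<^sup>*\<close> this integral is positive and \<open>u\<^sub>\<epsilon>\<close> stays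
  uniformly small, hence \<open>u = 0\<close> there.

  Suppose \<open>u\<close> is continuous at \<open>t\<^sup>*\<close>. By (A2), \<open>0\<close> is the only critical point near \<open>0\<close> for times near
  \<open>t\<^sup>*\<close>, so \<open>u = 0\<close> also shortly after \<open>t\<^sup>*\<close>, except perhaps on \<open>J\<close>. By (F2) the weighted energy
  \<open>(F + C\<^sub>2 / C\<^sub>1) exp (- C\<^sub>1 t)\<close> decreases along the flow, and an excursion of \<open>u\<^sub>\<epsilon>\<close> to distance
  \<open>\<delta>\<close> from \<open>0\<close> and back would cost an amount of energy that does not depend on \<open>\<epsilon>\<close>; over a short time
  interval with \<open>u = 0\<close> at both ends this is impossible. Thus \<open>u\<^sub>\<epsilon> \<rightarrow> 0\<close> uniformly on \<open>[0, t\<^sub>1]\<close> for some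
  \<open>t\<^sub>1 > t\<^sup>*\<close> with \<open>\<integral>\<lambda>\<^sub>1 < 0\<close> over \<open>[0, t\<^sub>1]\<close>. By (A1) the cone in which the \<open>e\<^sub>1\<close>-component dominates is
  invariant while \<open>u\<^sub>\<epsilon>\<close> is small, and in it this component grows exponentially in \<open>1 / \<epsilon>\<close>, starting from
  a power of \<open>\<epsilon>\<close>, which contradicts smallness.
\<close>

section \<open>Linear algebra\<close>

text \<open>Composing a permutation with the transposition of \<open>b\<close> and \<open>j\<close>
  flips its sign and leaves every factor alone, because \<open>M\<close> agrees at the two vectors.
  Hence the sum is its own negative.\<close>

lemma sum_sign_permutations_eq_0:
  fixes M :: "'a::euclidean_space \<Rightarrow> 'a"
  assumes "b \<in> Basis" "j \<in> Basis" "b \<noteq> j" "M b = M j"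
  shows "(\<Sum>p | p permutes (Basis :: 'a set). of_int (sign p) * (\<Prod>i\<in>Basis. M (p i) \<bullet> i)) = 0"
    (is "sum ?f ?P = 0")
proof -
  let ?\<tau> = "Transposition.transpose b j"
  have \<tau>: "?\<tau> permutes Basis"
    using assms by (simp add: permutes_swap_id)
  have "?f (?\<tau> \<circ> p) = - ?f p" if "p \<in> ?P" for p
  proof -
    have "permutation p" "permutation ?\<tau>"
      using that \<tau> by (auto simp: permutation_permutes intro: finite_Basis)
    then have "sign (?\<tau> \<circ> p) = - sign p"
      using assms by (simp add: sign_compose sign_swap_id)
    moreover have "M (?\<tau> x) = M x" for x
      using assms by (auto simp: Transposition.transpose_def)
    ultimately show ?thesis
      by simp
  qed
  then have "sum ?f ?P = - sum ?f ?P"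
    using setum_permutations_compose_left[OF \<tau>, of ?f] by (simp add: sum_negf)
  then show ?thesis
    by simp
qed

text \<open>Cramer's rule: put \<open>A v\<close>, which is 0, in place of the column of
  \<open>A\<close> at \<open>b\<close> and expand by linearity in that column. Terms with a repeated
  column vanish, so only \<open>(v \<bullet> b) * det_op A\<close> survives, and it must be
  0.\<close>

lemma det_op_nonzero_imp_injective:
  fixes A :: "'a::euclidean_space \<Rightarrow> 'a"
  assumes "linear A" "det_op A \<noteq> 0" "A v = 0"
  shows "v = 0"
proof (rule ccontr)
  assume "v \<noteq> 0"
  then obtain b where b: "b \<in> Basis" "v \<bullet> b \<noteq> 0"
    using euclidean_all_zero_iff by blast
  \<comment> \<open>The determinant of \<open>A\<close> with the column at \<open>b\<close> replaced
    by \<open>w\<close>.\<close>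
  define D where "D w = (\<Sum>p | p permutes (Basis :: 'a set).
      of_int (sign p) * (\<Prod>i\<in>Basis. (A(b := w)) (p i) \<bullet> i))" for w
  \<comment> \<open>In each Leibniz product \<open>w\<close> occurs in exactly one factor, that of
    row \<open>inv p b\<close>. Isolating it lets linearity of \<open>D\<close> be checked term by
    term.\<close>
  have prod_eq: "(\<Prod>i\<in>Basis. (A(b := w)) (p i) \<bullet> i) =
      (w \<bullet> inv p b) * (\<Prod>i\<in>Basis - {inv p b}. A (p i) \<bullet> i)"
    if p: "p permutes (Basis :: 'a set)" for p w
  proof -
    have i: "inv p b \<in> Basis" "p (inv p b) = b"
      using p b by (simp_all add: permutes_inv permutes_in_image permutes_inverses)
    have "p i \<noteq> b" if "i \<noteq> inv p b" for i
      using that p by (metis permutes_inverses(2))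
    then have "(\<Prod>i\<in>Basis - {inv p b}. (A(b := w)) (p i) \<bullet> i) = (\<Prod>i\<in>Basis - {inv p b}. A (p i) \<bullet> i)"
      by (intro prod.cong) auto
    then show ?thesis
      using i by (subst prod.remove[of _ "inv p b"]) auto
  qed
  have "linear D"
  proof (rule linearI)
    fix x y c
    show "D (x + y) = D x + D y"
      unfolding D_def sum.distrib[symmetric]
      by (intro sum.cong refl) (simp only: mem_Collect_eq prod_eq inner_add_left distrib_right distrib_left)
    show "D (c *\<^sub>R x) = c *\<^sub>R D x"
      unfolding D_def real_scaleR_def sum_distrib_left
      by (intro sum.cong refl) (simp only: mem_Collect_eq prod_eq inner_scaleR_left mult.assoc mult.left_commute)
  qed
  have "D (A j) = 0" if "j \<in> Basis - {b}" for j
    unfolding D_def using that b by (intro sum_sign_permutations_eq_0[of b j]) auto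
  then have "(\<Sum>j\<in>Basis. (v \<bullet> j) *\<^sub>R D (A j)) = (v \<bullet> b) *\<^sub>R D (A b)"
    using b by (subst sum.remove[of _ b]) auto
  moreover have "(\<Sum>j\<in>Basis. (v \<bullet> j) *\<^sub>R D (A j)) = D (A (\<Sum>j\<in>Basis. (v \<bullet> j) *\<^sub>R j))"
    using \<open>linear D\<close> \<open>linear A\<close> by (simp add: linear_sum linear_cmul)
  moreover have "D (A (\<Sum>j\<in>Basis. (v \<bullet> j) *\<^sub>R j)) = 0"
    using \<open>A v = 0\<close> \<open>linear D\<close> by (simp add: euclidean_representation linear_0)
  moreover have "D (A b) = det_op A"
    by (simp add: D_def det_op_def)
  ultimately show False
    using b assms by simp
qed

text \<open>The mixed second difference of \<phi> over the parallelogram with sides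
  \<open>s *\<^sub>R h\<close> and \<open>s *\<^sub>R k\<close> is symmetric in \<open>h\<close> and
  \<open>k\<close>, and up to an error of smaller order than the square of \<open>s\<close> it is
  given by either of the two inner products. This makes the Hessians self-adjoint.\<close>

lemma second_derivative_symmetric:
  fixes \<phi> :: "'a::real_inner \<Rightarrow> real"
  assumes \<phi>: "\<And>y. GDERIV \<phi> y :> \<gamma> y"
    and \<gamma>: "(\<gamma> has_derivative D) (at x)"
  shows "D h \<bullet> k = D k \<bullet> h"
proof -
  have D: "bounded_linear D"
    using \<gamma> by (rule has_derivative_bounded_linear)
  have *: "\<exists>d>0. \<forall>s. 0 < s \<and> s < d \<longrightarrow>
      \<bar>\<phi> (x + s *\<^sub>R h + s *\<^sub>R k) - \<phi> (x + s *\<^sub>R h) - \<phi> (x + s *\<^sub>R k) + \<phi> x - s\<^sup>2 * (D k \<bullet> h)\<bar>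
        \<le> e * s\<^sup>2" if "e > 0" for e and h k :: 'a
  proof -
    define N where "N = norm h + norm k + 1"
    have N: "N > 0" "norm h \<le> N" "norm h + norm k < N"
      by (auto simp: N_def add_nonneg_pos)
    \<comment> \<open>Chosen so that the error \<open>s * (N * (2 * (e' * (s * N))))\<close> reached
      below is exactly \<open>e * s\<^sup>2\<close>.\<close>
    define e' where "e' = e / (2 * N * N)"
    have "e' > 0"
      using N \<open>e > 0\<close> by (simp add: e'_def)
    then obtain d where d: "d > 0"
      "\<And>y. norm (y - x) < d \<Longrightarrow> norm (\<gamma> y - \<gamma> x - D (y - x)) \<le> e' * norm (y - x)"
      using \<gamma> unfolding has_derivative_within_alt by blast
    have "\<bar>\<phi> (x + s *\<^sub>R h + s *\<^sub>R k) - \<phi> (x + s *\<^sub>R h) - \<phi> (x + s *\<^sub>R k) + \<phi> x - s\<^sup>2 * (D k \<bullet> h)\<bar>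
        \<le> e * s\<^sup>2" if s: "0 < s" "s < d / N" for s
    proof -
      \<comment> \<open>\<open>\<psi> 1 - \<psi> 0\<close> is the mixed second difference. The mean
        value theorem in \<theta> turns it into a difference of gradients at two points within
        \<open>s * N\<close> of \<open>x\<close>, where the differentiability of \<gamma> at
        \<open>x\<close> applies.\<close>
      define \<psi> where "\<psi> \<theta> = \<phi> (x + \<theta> *\<^sub>R (s *\<^sub>R h) + s *\<^sub>R k) - \<phi> (x + \<theta> *\<^sub>R (s *\<^sub>R h))" for \<theta> :: real
      define \<psi>' where "\<psi>' \<theta> = s * (h \<bullet> (\<gamma> (x + \<theta> *\<^sub>R (s *\<^sub>R h) + s *\<^sub>R k) - \<gamma> (x + \<theta> *\<^sub>R (s *\<^sub>R h))))" for \<theta>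
      have \<phi>': "(\<phi> has_derivative (\<lambda>h. h \<bullet> \<gamma> y)) (at y)" for y
        using \<phi>[of y] by (simp add: gderiv_def)
      have "(\<psi> has_derivative (\<lambda>t. \<psi>' \<theta> * t)) (at \<theta>)" for \<theta>
        unfolding \<psi>_def \<psi>'_def
        by (rule derivative_eq_intros has_derivative_compose[OF _ \<phi>'] refl)+
           (simp add: fun_eq_iff algebra_simps inner_diff_right)
      then have "DERIV \<psi> \<theta> :> \<psi>' \<theta>" for \<theta>
        by (simp add: has_field_derivative_def)
      then obtain \<theta> where \<theta>: "0 < \<theta>" "\<theta> < 1" "\<psi> 1 - \<psi> 0 = \<psi>' \<theta>"
        using MVT2[of 0 1 \<psi> \<psi>'] by auto
      define p where "p = \<theta> *\<^sub>R (s *\<^sub>R h)"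
      have p: "norm p \<le> s * norm h"
        using \<theta> s by (simp add: p_def mult_left_le_one_le)
      have "norm (p + s *\<^sub>R k) \<le> s * norm h + s * norm k"
        using p s by (intro norm_triangle_le) simp
      also have "\<dots> = s * (norm h + norm k)"
        by (simp add: distrib_left)
      also have "\<dots> \<le> s * N"
        using s N by (intro mult_left_mono) auto
      finally have pk: "norm (p + s *\<^sub>R k) \<le> s * N" .
      have p': "norm p \<le> s * N"
        using s N by (intro order_trans[OF p] mult_left_mono) auto
      have sN: "s * N < d"
        using s N by (simp add: field_simps)
      have near: "norm (\<gamma> (x + z) - \<gamma> x - D z) \<le> e' * (s * N)" if "norm z \<le> s * N" for z
      proof -
        have "norm (\<gamma> (x + z) - \<gamma> x - D z) \<le> e' * norm z"
          using d(2)[of "x + z"] that sN by simp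
        also have "\<dots> \<le> e' * (s * N)"
          using that \<open>e' > 0\<close> by (intro mult_left_mono) auto
        finally show ?thesis .
      qed
      have eq: "\<gamma> (x + p + s *\<^sub>R k) - \<gamma> (x + p) - s *\<^sub>R D k =
          (\<gamma> (x + (p + s *\<^sub>R k)) - \<gamma> x - D (p + s *\<^sub>R k)) - (\<gamma> (x + p) - \<gamma> x - D p)"
        using D by (simp add: linear_simps add.assoc)
      have "norm (\<gamma> (x + p + s *\<^sub>R k) - \<gamma> (x + p) - s *\<^sub>R D k) \<le> e' * (s * N) + e' * (s * N)"
        unfolding eq by (intro order_trans[OF norm_triangle_ineq4] add_mono near pk p')
      then have "norm (\<gamma> (x + p + s *\<^sub>R k) - \<gamma> (x + p) - s *\<^sub>R D k) \<le> 2 * (e' * (s * N))"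
        by (simp only: mult_2)
      then have "\<bar>h \<bullet> (\<gamma> (x + p + s *\<^sub>R k) - \<gamma> (x + p) - s *\<^sub>R D k)\<bar> \<le> N * (2 * (e' * (s * N)))"
        using N by (intro order_trans[OF Cauchy_Schwarz_ineq2] mult_mono) auto
      then have "\<bar>s * (h \<bullet> (\<gamma> (x + p + s *\<^sub>R k) - \<gamma> (x + p) - s *\<^sub>R D k))\<bar> \<le> s * (N * (2 * (e' * (s * N))))"
        using s by (simp add: abs_mult)
      moreover have "s * (N * (2 * (e' * (s * N)))) = e * s\<^sup>2"
        using N by (simp add: e'_def power2_eq_square field_simps)
      moreover have "s * (h \<bullet> (\<gamma> (x + p + s *\<^sub>R k) - \<gamma> (x + p) - s *\<^sub>R D k)) =
          \<psi> 1 - \<psi> 0 - s\<^sup>2 * (D k \<bullet> h)"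
        unfolding \<theta>(3) \<psi>'_def p_def[symmetric]
        by (simp add: inner_diff_right algebra_simps power2_eq_square inner_commute)
      ultimately show ?thesis
        by (simp add: \<psi>_def algebra_simps)
    qed
    moreover have "d / N > 0"
      using d N by simp
    ultimately show ?thesis
      by blast
  qed
  have "\<bar>D h \<bullet> k - D k \<bullet> h\<bar> \<le> e" if "e > 0" for e
  proof -
    obtain d1 where d1: "d1 > 0" "\<And>s. 0 < s \<Longrightarrow> s < d1 \<Longrightarrow>
      \<bar>\<phi> (x + s *\<^sub>R h + s *\<^sub>R k) - \<phi> (x + s *\<^sub>R h) - \<phi> (x + s *\<^sub>R k) + \<phi> x - s\<^sup>2 * (D k \<bullet> h)\<bar>
        \<le> e / 2 * s\<^sup>2"
      using *[of "e / 2" h k] \<open>e > 0\<close> by auto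
    obtain d2 where d2: "d2 > 0" "\<And>s. 0 < s \<Longrightarrow> s < d2 \<Longrightarrow>
      \<bar>\<phi> (x + s *\<^sub>R k + s *\<^sub>R h) - \<phi> (x + s *\<^sub>R k) - \<phi> (x + s *\<^sub>R h) + \<phi> x - s\<^sup>2 * (D h \<bullet> k)\<bar>
        \<le> e / 2 * s\<^sup>2"
      using *[of "e / 2" k h] \<open>e > 0\<close> by auto
    define s where "s = min d1 d2 / 2"
    have s: "0 < s" "s < d1" "s < d2"
      using d1 d2 by (auto simp: s_def)
    have "\<bar>s\<^sup>2 * (D h \<bullet> k) - s\<^sup>2 * (D k \<bullet> h)\<bar> \<le> e * s\<^sup>2"
      using d1(2)[OF s(1,2)] d2(2)[OF s(1,3)] add.commute[of "s *\<^sub>R h" "s *\<^sub>R k"]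
      unfolding add.assoc by (simp only:)
    moreover have "\<bar>s\<^sup>2 * (D h \<bullet> k) - s\<^sup>2 * (D k \<bullet> h)\<bar> = s\<^sup>2 * \<bar>D h \<bullet> k - D k \<bullet> h\<bar>"
      by (simp only: abs_mult right_diff_distrib[symmetric]) simp
    ultimately have "s\<^sup>2 * \<bar>D h \<bullet> k - D k \<bullet> h\<bar> \<le> s\<^sup>2 * e"
      by (simp only: mult.commute)
    then show ?thesis
      using s by simp
  qed
  then have "\<bar>D h \<bullet> k - D k \<bullet> h\<bar> \<le> 0"
    by (rule field_le_epsilon[of _ 0, simplified])
  then show ?thesis
    by simp
qed

text \<open>Rayleigh's principle. The quadratic form attains a minimum \<open>m\<close> on the
  compact unit sphere, a minimiser is an eigenvector, and every eigenvalue is the value of the form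
  at a unit eigenvector, hence at least \<open>m\<close>. So the \<open>LEAST\<close> is attained
  and equals \<open>m\<close>.\<close>

lemma min_eigenvalue_self_adjoint:
  fixes A :: "'a::euclidean_space \<Rightarrow> 'a"
  assumes A: "linear A" and sym: "\<And>x y. A x \<bullet> y = A y \<bullet> x"
  shows "min_eigenvalue A * (norm x)\<^sup>2 \<le> A x \<bullet> x"
    and "A x \<bullet> x = min_eigenvalue A * (norm x)\<^sup>2 \<Longrightarrow> A x = min_eigenvalue A *\<^sub>R x"
    and "\<exists>v. norm v = 1 \<and> A v = min_eigenvalue A *\<^sub>R v"
proof -
  have cont: "continuous_on S A" for S
    using A by (simp add: linear_continuous_on linear_linear)
  have "sphere (0::'a) 1 \<noteq> {}"
    by simp
  then obtain v where v: "v \<in> sphere 0 1" "\<And>y. y \<in> sphere 0 1 \<Longrightarrow> A v \<bullet> v \<le> A y \<bullet> y"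
    using continuous_attains_inf[of "sphere (0::'a) 1" "\<lambda>x. A x \<bullet> x"]
      continuous_on_inner[OF cont continuous_on_id] by (auto simp: Ball_def)
  define m where "m = A v \<bullet> v"
  have low: "m * (norm x)\<^sup>2 \<le> A x \<bullet> x" for x
  proof (cases "x = 0")
    case False
    then have "m \<le> A (x /\<^sub>R norm x) \<bullet> (x /\<^sub>R norm x)"
      unfolding m_def by (intro v) simp
    also have "\<dots> = (A x \<bullet> x) / (norm x)\<^sup>2"
      using A by (simp add: linear_cmul power2_eq_square field_simps)
    finally show ?thesis
      using False by (simp add: field_simps)
  qed (simp add: linear_0[OF A])
  \<comment> \<open>A zero of the nonnegative quadratic form of \<open>A - m\<close> is a critical point of it.\<close>
  have crit: "A x = m *\<^sub>R x" if x: "A x \<bullet> x = m * (norm x)\<^sup>2" for x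
  proof -
    define z where "z = A x - m *\<^sub>R x"
    define q where "q = A z \<bullet> z - m * (norm z)\<^sup>2"
    have q: "q \<ge> 0"
      using low[of z] by (simp add: q_def)
    have "0 \<le> 2 * s * (norm z)\<^sup>2 + s\<^sup>2 * q" for s
    proof -
      have "m * (norm (x + s *\<^sub>R z))\<^sup>2 \<le> A (x + s *\<^sub>R z) \<bullet> (x + s *\<^sub>R z)"
        by (rule low)
      also have "A (x + s *\<^sub>R z) \<bullet> (x + s *\<^sub>R z) = A x \<bullet> x + 2 * s * (A x \<bullet> z) + s\<^sup>2 * (A z \<bullet> z)"
        using A sym[of x z] by (simp add: linear_add linear_cmul algebra_simps power2_eq_square inner_commute)
      also have "(norm (x + s *\<^sub>R z))\<^sup>2 = (norm x)\<^sup>2 + 2 * s * (x \<bullet> z) + s\<^sup>2 * (norm z)\<^sup>2"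
        by (simp add: power2_norm_eq_inner algebra_simps power2_eq_square[of s] inner_commute)
      finally have "0 \<le> 2 * s * (A x \<bullet> z - m * (x \<bullet> z)) + s\<^sup>2 * q"
        using x by (simp add: q_def algebra_simps)
      also have "A x \<bullet> z - m * (x \<bullet> z) = (norm z)\<^sup>2"
        unfolding power2_norm_eq_inner by (subst (3) z_def) (simp add: inner_diff_left)
      finally show ?thesis .
    qed
    \<comment> \<open>Since the variation is along the residual \<open>z\<close>, the term linear in
      \<open>s\<close> is \<open>2 * s * (norm z)\<^sup>2\<close>. For this negative
      \<open>s\<close> it outweighs the quadratic term; the denominator \<open>q + 1\<close> also
      covers \<open>q = 0\<close>.\<close>
    from this[of "- (norm z)\<^sup>2 / (q + 1)"] have "0 \<le> - ((norm z)\<^sup>2)\<^sup>2 * ((q + 2) / (q + 1)\<^sup>2)"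
      using q by (simp add: divide_simps power2_eq_square) (simp add: algebra_simps)
    moreover have "(q + 2) / (q + 1)\<^sup>2 > 0"
      using q by simp
    ultimately have "0 \<le> - ((norm z)\<^sup>2)\<^sup>2"
      by (metis mult_neg_pos not_le)
    then show ?thesis
      by (simp add: z_def)
  qed
  have eig: "A v = m *\<^sub>R v"
    using v(1) by (intro crit) (simp add: m_def)
  have "min_eigenvalue A = m"
    unfolding min_eigenvalue_def
  proof (rule Least_equality)
    show "eigenvalue A m"
      unfolding eigenvalue_def using eig v(1) by (intro exI[of _ v]) auto
    fix c assume "eigenvalue A c"
    then obtain w where w: "w \<noteq> 0" "A w = c *\<^sub>R w"
      by (auto simp: eigenvalue_def)
    then have "m * (norm w)\<^sup>2 \<le> c * (norm w)\<^sup>2"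
      using low[of w] by (simp add: power2_norm_eq_inner)
    then show "m \<le> c"
      using w by simp
  qed
  then show "min_eigenvalue A * (norm x)\<^sup>2 \<le> A x \<bullet> x"
    and "A x \<bullet> x = min_eigenvalue A * (norm x)\<^sup>2 \<Longrightarrow> A x = min_eigenvalue A *\<^sub>R x"
    and "\<exists>v. norm v = 1 \<and> A v = min_eigenvalue A *\<^sub>R v"
    using low crit eig v(1) by auto
qed

section \<open>Consequences of (F0)\<close>

text \<open>Applying the joint first and second derivatives to vectors of the form
  \<open>(0, h)\<close> yields the spatial ones, and \<open>B\<close> inherits joint continuity from
  \<open>f''\<close>.\<close>

lemma F0_obtain_hessian:
  fixes F :: "real \<Rightarrow> 'a::euclidean_space \<Rightarrow> real"
  assumes "F0 T F"
  obtains B :: "real \<times> 'a \<Rightarrow> 'a \<Rightarrow>\<^sub>L 'a" where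
    "continuous_on ({0..T} \<times> UNIV) B"
    "\<And>t x. t \<in> {0..T} \<Longrightarrow> GDERIV (F t) x :> gradient (F t) x"
    "\<And>t x. t \<in> {0..T} \<Longrightarrow> (gradient (F t) has_derivative B (t, x)) (at x)"
proof -
  let ?Z = "{0..T} \<times> (UNIV :: 'a set)"
  obtain f' :: "real \<times> 'a \<Rightarrow> (real \<times> 'a) \<Rightarrow>\<^sub>L real"
    and f'' :: "real \<times> 'a \<Rightarrow> (real \<times> 'a) \<Rightarrow>\<^sub>L (real \<times> 'a) \<Rightarrow>\<^sub>L real" where
    f': "\<And>z. z \<in> ?Z \<Longrightarrow> ((\<lambda>(t, x). F t x) has_derivative f' z) (at z within ?Z)" and
    f'': "\<And>z. z \<in> ?Z \<Longrightarrow> (f' has_derivative f'' z) (at z within ?Z)" and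
    cont: "continuous_on ?Z f''"
    using assms unfolding F0_def C2_on_def by blast
  define g where "g t x = (\<Sum>i\<in>Basis. (f' (t, x) (0, i)) *\<^sub>R i)" for t and x :: 'a
  \<comment> \<open>Built from matrix entries, so that continuity in operator norm reduces to that
    of finitely many evaluations of \<open>f''\<close>.\<close>
  define B where "B z = blinfun_of_matrix (\<lambda>i j. f'' z (0, j) (0, i))" for z
  \<comment> \<open>A time slice is a full copy of the space inside the strip, so a derivative
    within the strip restricts to an unrestricted derivative in \<open>x\<close>, also at the end
    times 0 and \<open>T\<close>.\<close>
  have slice: "((\<lambda>x. \<phi> (t, x)) has_derivative (\<lambda>h. \<phi>' (0, h))) (at x)"
    if "t \<in> {0..T}" "(\<phi> has_derivative \<phi>') (at (t, x) within ?Z)"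
    for t x \<phi>' and \<phi> :: "real \<times> 'a \<Rightarrow> 'c::real_normed_vector"
  proof -
    have "((\<lambda>x. (t, x)) has_derivative (\<lambda>h. (0, h))) (at x)"
      by (auto intro!: derivative_eq_intros)
    moreover have "(\<phi> has_derivative \<phi>') (at (t, x) within range (Pair t))"
      using that by (auto intro: has_derivative_subset)
    ultimately show ?thesis
      by (rule has_derivative_in_compose)
  qed
  have GD: "GDERIV (F t) x :> g t x" if t: "t \<in> {0..T}" for t x
  proof -
    have "(F t has_derivative (\<lambda>h. f' (t, x) (0, h))) (at x)"
      using slice[OF t f', of x] t by simp
    moreover have "f' (t, x) (0, h) = h \<bullet> g t x" for h
    proof -
      have lin: "linear (\<lambda>h. f' (t, x) (0, h))"
        by (rule linear_compose[OF _ bounded_linear.linear[OF blinfun.bounded_linear_right],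
              of "Pair 0", unfolded o_def]) (auto intro!: linearI)
      have "f' (t, x) (0, \<Sum>i\<in>Basis. (h \<bullet> i) *\<^sub>R i) = (\<Sum>i\<in>Basis. (h \<bullet> i) *\<^sub>R f' (t, x) (0, i))"
        using linear_sum[OF lin, of "\<lambda>i. (h \<bullet> i) *\<^sub>R i" Basis] by (simp add: linear_cmul[OF lin])
      then show ?thesis
        by (simp add: g_def inner_sum_right euclidean_representation mult.commute)
    qed
    ultimately show ?thesis
      by (simp add: gderiv_def)
  qed
  have grad: "gradient (F t) x = g t x" if "t \<in> {0..T}" for t x
    unfolding gradient_def
  proof (rule the_equality)
    show "GDERIV (F t) x :> g t x"
      using that by (rule GD)
    fix D assume "GDERIV (F t) x :> D"
    then have "(\<lambda>h. h \<bullet> D) = (\<lambda>h. h \<bullet> g t x)"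
      using GD[OF that] has_derivative_unique unfolding gderiv_def by blast
    then show "D = g t x"
      by (metis vector_eq_ldot)
  qed
  have der: "(gradient (F t) has_derivative B (t, x)) (at x)" if t: "t \<in> {0..T}" for t x
  proof -
    have "((\<lambda>x. f' (t, x)) has_derivative (\<lambda>h. f'' (t, x) (0, h))) (at x)"
      using slice[OF t f'', of x] t by simp
    then have "(g t has_derivative (\<lambda>h. \<Sum>i\<in>Basis. (f'' (t, x) (0, h) (0, i)) *\<^sub>R i)) (at x)"
      unfolding g_def by (auto intro!: derivative_eq_intros)
    moreover have "(\<Sum>i\<in>Basis. (f'' (t, x) (0, h) (0, i)) *\<^sub>R i) = B (t, x) h" for h
    proof -
      have "f'' (t, x) (0, h) (0, i) = (\<Sum>j\<in>Basis. (h \<bullet> j) * f'' (t, x) (0, j) (0, i))" for i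
      proof -
        have lin: "linear (\<lambda>h. f'' (t, x) (0, h) (0, i))"
          using blinfun.add_right[of "f'' (t, x)" "(0, _)" "(0, _)"] blinfun.scaleR_right[of "f'' (t, x)" _ "(0, _)"]
          by (intro linearI) (simp_all add: blinfun.add_left blinfun.scaleR_left)
        have "f'' (t, x) (0, \<Sum>j\<in>Basis. (h \<bullet> j) *\<^sub>R j) (0, i) = (\<Sum>j\<in>Basis. (h \<bullet> j) *\<^sub>R f'' (t, x) (0, j) (0, i))"
          using linear_sum[OF lin, of "\<lambda>i. (h \<bullet> i) *\<^sub>R i" Basis] by (simp add: linear_cmul[OF lin])
        then show ?thesis
          by (simp add: euclidean_representation)
      qed
      then show ?thesis
        by (simp add: B_def blinfun_of_matrix_apply scaleR_sum_left)
    qed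
    ultimately show ?thesis
      using grad[OF t] by (simp add: ext[of "gradient (F t)" "g t"])
  qed
  have "continuous_on ?Z B"
    unfolding B_def using cont
    by (intro continuous_intros)
  with GD grad der show thesis
    by (intro that[of B]) auto
qed

lemma F0_continuous_on:
  assumes "F0 T F"
  shows "continuous_on ({0..T} \<times> UNIV) (\<lambda>(t, x). F t x)"
  using assms unfolding F0_def C2_on_def
  by (metis continuous_on_eq_continuous_within has_derivative_continuous)

text \<open>Along a curve the joint derivative acts on \<open>(1, v) = (1, 0) + (0, v)\<close>. The
  constant curve identifies the first part with the time derivative that occurs in (F2), well
  defined because \<open>T > 0\<close>; the second part is the gradient term.\<close>

lemma F0_chain_rule:
  fixes F :: "real \<Rightarrow> 'a::euclidean_space \<Rightarrow> real"
  assumes "F0 T F" "T > 0" "t \<in> {0..T}"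
    and u: "(u has_vector_derivative v) (at t within {0..T})"
  shows "((\<lambda>s. F s (u s)) has_real_derivative
    vector_derivative (\<lambda>s. F s (u t)) (at t within {0..T}) + v \<bullet> gradient (F t) (u t)) (at t within {0..T})"
proof -
  let ?Z = "{0..T} \<times> (UNIV :: 'a set)"
  obtain f' :: "real \<times> 'a \<Rightarrow> (real \<times> 'a) \<Rightarrow>\<^sub>L real" where
    f': "\<And>z. z \<in> ?Z \<Longrightarrow> ((\<lambda>(t, x). F t x) has_derivative f' z) (at z within ?Z)"
    using \<open>F0 T F\<close> unfolding F0_def C2_on_def by blast
  have curve: "((\<lambda>s. F s (w s)) has_vector_derivative f' (t, w t) (1, w')) (at t within {0..T})"
    if w: "(w has_vector_derivative w') (at t within {0..T})" for w w'
  proof -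
    have "((\<lambda>s. (s, w s)) has_derivative (\<lambda>h. (h, h *\<^sub>R w'))) (at t within {0..T})"
      using w unfolding has_vector_derivative_def by (auto intro!: derivative_eq_intros)
    moreover have "((\<lambda>(t, x). F t x) has_derivative f' (t, w t)) (at (t, w t) within (\<lambda>s. (s, w s)) ` {0..T})"
      using f'[of "(t, w t)"] \<open>t \<in> {0..T}\<close> by (auto intro!: has_derivative_subset[where t = "(\<lambda>s. (s, w s)) ` {0..T}"])
    ultimately have "((\<lambda>s. F s (w s)) has_derivative (\<lambda>h. f' (t, w t) (h, h *\<^sub>R w'))) (at t within {0..T})"
      using has_derivative_in_compose by fastforce
    moreover have "f' (t, w t) (h, h *\<^sub>R w') = h *\<^sub>R f' (t, w t) (1, w')" for h
      using blinfun.scaleR_right[of "f' (t, w t)" h "(1, w')"] by simp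
    ultimately show ?thesis
      by (simp add: has_vector_derivative_def)
  qed
  have "vector_derivative (\<lambda>s. F s (u t)) (at t within {0..T}) = f' (t, u t) (1, 0)"
    using assms(2,3) curve[of "\<lambda>_. u t" 0]
    by (intro vector_derivative_within_cbox[of 0 T, unfolded cbox_interval]) auto
  moreover have "v \<bullet> gradient (F t) (u t) = f' (t, u t) (0, v)"
  proof -
    obtain B :: "real \<times> 'a \<Rightarrow> 'a \<Rightarrow>\<^sub>L 'a" where
      "GDERIV (F t) (u t) :> gradient (F t) (u t)"
      using F0_obtain_hessian[OF \<open>F0 T F\<close>] \<open>t \<in> {0..T}\<close> by metis
    then have "(F t has_derivative (\<lambda>h. h \<bullet> gradient (F t) (u t))) (at (u t))"
      by (simp add: gderiv_def)
    moreover have "(F t has_derivative (\<lambda>h. f' (t, u t) (0, h))) (at (u t))"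
    proof -
      have "((\<lambda>x. (t, x)) has_derivative (\<lambda>h. (0, h))) (at (u t))"
        by (auto intro!: derivative_eq_intros)
      moreover have "((\<lambda>(t, x). F t x) has_derivative f' (t, u t)) (at (t, u t) within range (Pair t))"
          using f'[of "(t, u t)"] \<open>t \<in> {0..T}\<close> by (auto intro!: has_derivative_subset[where t = "range (Pair t)"])
      ultimately show ?thesis
        using has_derivative_in_compose by fastforce
    qed
    ultimately show ?thesis
      by (metis has_derivative_unique)
  qed
  moreover have "f' (t, u t) (1, v) = f' (t, u t) (1, 0) + f' (t, u t) (0, v)"
    by (simp flip: blinfun.add_right)
  ultimately show ?thesis
    using curve[OF u] by (simp add: has_real_derivative_iff_has_vector_derivative)
qed

text \<open>\<open>B\<close> is uniformly continuous on the compact set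
  \<open>{0..T} \<times> cball 0 1\<close>, so \<open>B (t, y)\<close> is \<eta>-close to
  \<open>B (t, 0)\<close> for small \<open>y\<close>, uniformly in \<open>t\<close>. The mean value
  inequality on the segment from 0 to \<open>x\<close> does the rest.\<close>

lemma uniform_linearization_at_0:
  fixes f :: "real \<Rightarrow> 'a::euclidean_space \<Rightarrow> 'a"
  assumes B: "continuous_on ({0..T} \<times> UNIV) B"
    and f: "\<And>t x. t \<in> {0..T} \<Longrightarrow> (f t has_derivative blinfun_apply (B (t, x))) (at x)"
    and f0: "\<And>t. t \<in> {0..T} \<Longrightarrow> f t 0 = 0"
    and "\<eta> > 0"
  obtains \<delta> where "\<delta> > 0"
    "\<And>t x. t \<in> {0..T} \<Longrightarrow> norm x \<le> \<delta> \<Longrightarrow> norm (f t x - B (t, 0) x) \<le> \<eta> * norm x"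
proof -
  have "compact ({0..T} \<times> cball (0::'a) 1)"
    by (intro compact_Times) auto
  moreover have "continuous_on ({0..T} \<times> cball (0::'a) 1) B"
    using B by (rule continuous_on_subset) auto
  ultimately have "uniformly_continuous_on ({0..T} \<times> cball (0::'a) 1) B"
    by (simp add: compact_uniformly_continuous)
  then obtain d where d: "d > 0" "\<And>z z'. z \<in> {0..T} \<times> cball 0 1 \<Longrightarrow> z' \<in> {0..T} \<times> cball 0 1 \<Longrightarrow>
      dist z' z < d \<Longrightarrow> dist (B z') (B z) < \<eta>"
    using \<open>\<eta> > 0\<close> unfolding uniformly_continuous_on_def by metis
  define \<delta> where "\<delta> = min 1 (d / 2)"
  have "norm (f t x - B (t, 0) x) \<le> \<eta> * norm x" if t: "t \<in> {0..T}" and x: "norm x \<le> \<delta>" for t x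
  proof -
    have "norm (f t x - f t 0 - B (t, 0) (x - 0)) \<le> norm (x - 0) * \<eta>"
    proof (rule differentiable_bound_linearization[where S = "cball 0 \<delta>" and f' = "\<lambda>y. blinfun_apply (B (t, y))"])
      fix s :: real assume "s \<in> {0..1}"
      then show "0 + s *\<^sub>R (x - 0) \<in> cball 0 \<delta>"
        using x by (simp add: mult_left_le_one_le order_trans[OF mult_left_le_one_le])
    next
      fix y :: 'a assume y: "y \<in> cball 0 \<delta>"
      show "(f t has_derivative blinfun_apply (B (t, y))) (at y within cball 0 \<delta>)"
        using f[OF t] by (rule has_derivative_at_withinI)
      have "dist (B (t, y)) (B (t, 0)) < \<eta>"
        using t y d(1) by (intro d(2)) (auto simp: \<delta>_def dist_Pair_Pair)
      then show "onorm (blinfun_apply (B (t, y)) - blinfun_apply (B (t, 0))) \<le> \<eta>"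
        by (simp add: dist_norm norm_blinfun.rep_eq minus_blinfun.rep_eq fun_diff_def)
    qed (use d in \<open>auto simp: \<delta>_def\<close>)
    then show ?thesis
      using f0[OF t] by (simp add: mult.commute)
  qed
  moreover have "\<delta> > 0"
    using d by (simp add: \<delta>_def)
  ultimately show thesis
    using that by blast
qed

section \<open>Estimates along the gradient flow\<close>

lemma derivative_nonpos_imp_le:
  fixes w :: "real \<Rightarrow> real"
  assumes "s \<le> t" "{s..t} \<subseteq> S"
    and der: "\<And>x. x \<in> {s..t} \<Longrightarrow> (w has_real_derivative w' x) (at x within S)"
    and nonpos: "\<And>x. x \<in> {s<..<t} \<Longrightarrow> w' x \<le> 0"
  shows "w t \<le> w s"
proof (rule DERIV_nonpos_imp_decreasing_open[OF \<open>s \<le> t\<close>])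
  have der': "(w has_real_derivative w' x) (at x within {s..t})" if "x \<in> {s..t}" for x
    using der[OF that] \<open>{s..t} \<subseteq> S\<close> by (rule DERIV_subset)
  then show "continuous_on {s..t} w"
    by (metis DERIV_continuous continuous_on_eq_continuous_within)
  fix x assume "s < x" "x < t"
  then show "\<exists>y. (w has_real_derivative y) (at x) \<and> y \<le> 0"
    using der'[of x] nonpos[of x] by (auto simp: at_within_Icc_at)
qed

text \<open>After the last time up to \<open>t\<close> at which \<open>w\<close> is nonpositive,
  \<open>w\<close> is positive and therefore nonincreasing, so it cannot have risen above 0.\<close>

lemma nonpos_barrier:
  fixes w :: "real \<Rightarrow> real"
  assumes "{a..b} \<subseteq> S"
    and der: "\<And>x. x \<in> {a..b} \<Longrightarrow> (w has_real_derivative w' x) (at x within S)"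
    and nonpos: "\<And>x. x \<in> {a..b} \<Longrightarrow> w x > 0 \<Longrightarrow> w' x \<le> 0"
    and "w a \<le> 0" "t \<in> {a..b}"
  shows "w t \<le> 0"
proof (rule ccontr)
  assume "\<not> w t \<le> 0"
  have cont: "continuous_on {a..b} w"
    using der \<open>{a..b} \<subseteq> S\<close> by (meson DERIV_continuous_on DERIV_subset)
  define N where "N = {a..t} \<inter> w -` {..0}"
  have "closed N"
    unfolding N_def using cont \<open>t \<in> {a..b}\<close>
    by (intro continuous_closed_preimage) (auto intro: continuous_on_subset)
  then have "compact N"
    by (metis N_def bounded_Int bounded_closed_interval compact_eq_bounded_closed box_real(2))
  moreover have "a \<in> N"
    using assms by (auto simp: N_def)
  ultimately obtain s where s: "s \<in> N" "\<And>x. x \<in> N \<Longrightarrow> x \<le> s"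
    using compact_attains_sup[of N] by auto
  have "w t \<le> w s"
  proof (rule derivative_nonpos_imp_le[where w = w and s = s and t = t and S = S and w' = w'])
    fix x assume x: "x \<in> {s<..<t}"
    then have "x \<notin> N"
      using s(2)[of x] by auto
    then show "w' x \<le> 0"
      using x s(1) \<open>t \<in> {a..b}\<close> by (intro nonpos) (auto simp: N_def)
  qed (use s assms in \<open>auto simp: N_def intro!: der\<close>)
  then show False
    using s(1) \<open>\<not> w t \<le> 0\<close> by (simp add: N_def)
qed

text \<open>At the first time with \<open>\<phi> \<ge> \<delta>\<close> equality holds by the
  intermediate value theorem, and \<open>step\<close> contradicts it. This turns estimates valid
  only while the solution is small into unconditional ones.\<close>

lemma continuous_bootstrap:
  fixes \<phi> :: "real \<Rightarrow> real"
  assumes cont: "continuous_on {a..b} \<phi>" and "\<phi> a < \<delta>"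
    and step: "\<And>t. t \<in> {a..b} \<Longrightarrow> (\<And>s. s \<in> {a..t} \<Longrightarrow> \<phi> s \<le> \<delta>) \<Longrightarrow> \<phi> t < \<delta>"
    and "t \<in> {a..b}"
  shows "\<phi> t < \<delta>"
proof (rule ccontr)
  assume "\<not> \<phi> t < \<delta>"
  define N where "N = {a..b} \<inter> \<phi> -` {\<delta>..}"
  have "closed N"
    unfolding N_def using cont by (rule continuous_closed_preimage) auto
  then have "compact N"
    by (metis N_def bounded_Int bounded_closed_interval compact_eq_bounded_closed box_real(2))
  moreover have "t \<in> N"
    using \<open>\<not> \<phi> t < \<delta>\<close> \<open>t \<in> {a..b}\<close> by (simp add: N_def)
  ultimately obtain s where s: "s \<in> N" "\<And>x. x \<in> N \<Longrightarrow> s \<le> x"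
    using compact_attains_inf[of N] by auto
  have "\<exists>x\<ge>a. x \<le> s \<and> \<phi> x = \<delta>"
    using s(1) cont \<open>\<phi> a < \<delta>\<close> by (intro IVT') (auto simp: N_def intro: continuous_on_subset)
  then obtain x where x: "a \<le> x" "x \<le> s" "\<phi> x = \<delta>"
    by blast
  then have "x = s"
    using s by (force simp: N_def)
  have "\<phi> s < \<delta>"
  proof (rule step)
    fix y assume "y \<in> {a..s}"
    then show "\<phi> y \<le> \<delta>"
      using s x \<open>x = s\<close> by (cases "y = s") (force simp: N_def)+
  qed (use s in \<open>simp add: N_def\<close>)
  then show False
    using x \<open>x = s\<close> by simp
qed

lemma has_real_derivative_inner:
  assumes "(v has_vector_derivative v') (at t within S)" "(w has_vector_derivative w') (at t within S)"
  shows "((\<lambda>t. v t \<bullet> w t) has_real_derivative (v t \<bullet> w' + v' \<bullet> w t)) (at t within S)"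
  using bounded_bilinear.has_vector_derivative[OF bounded_bilinear_inner assms]
  by (simp add: has_real_derivative_iff_has_vector_derivative)

lemma has_real_derivative_inner_self:
  assumes "(v has_vector_derivative v') (at t within S)"
  shows "((\<lambda>t. (norm (v t))\<^sup>2) has_real_derivative (2 * (v t \<bullet> v'))) (at t within S)"
  using has_real_derivative_inner[OF assms assms] by (simp add: power2_norm_eq_inner inner_commute)

lemma has_real_derivative_exp_integral:
  fixes m :: "real \<Rightarrow> real"
  assumes "continuous_on {0..T} m" "t \<in> {0..T}"
  shows "((\<lambda>t. exp (c * integral {0..t} m)) has_real_derivative
    c * m t * exp (c * integral {0..t} m)) (at t within {0..T})"
  using integral_has_real_derivative[OF assms] by (auto intro!: derivative_eq_intros)

text \<open>A Gronwall argument: while \<open>u\<close> stays in the ball,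
  \<open>(norm (u t))\<^sup>2\<close> times the integrating factor is nonincreasing, and the factor
  is at least 1. Only the integral of \<open>m\<close> must be nonnegative, \<open>m\<close> itself
  may change sign. The resulting bound keeps \<open>u\<close> strictly inside the ball, which closes
  a bootstrap.\<close>

lemma decay_of_small_solutions:
  fixes f :: "real \<Rightarrow> 'a::real_inner \<Rightarrow> 'a"
  assumes "\<epsilon> > 0" "t0 \<le> T"
    and sol: "\<And>t. t \<in> {0..T} \<Longrightarrow> (u has_vector_derivative (- (1 / \<epsilon>)) *\<^sub>R f t (u t)) (at t within {0..T})"
    and m: "continuous_on {0..T} m" "\<And>t. t \<in> {0..t0} \<Longrightarrow> integral {0..t} m \<ge> 0"
    and coercive: "\<And>t x. t \<in> {0..t0} \<Longrightarrow> norm x \<le> \<delta> \<Longrightarrow> m t * (norm x)\<^sup>2 \<le> x \<bullet> f t x"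
    and "norm (u 0) < \<delta>" "t \<in> {0..t0}"
  shows "norm (u t) \<le> norm (u 0)"
proof -
  define w where "w t = (norm (u t))\<^sup>2 * exp (2 / \<epsilon> * integral {0..t} m)" for t
  define w' where "w' t = 2 / \<epsilon> * exp (2 / \<epsilon> * integral {0..t} m) * (m t * (norm (u t))\<^sup>2 - u t \<bullet> f t (u t))" for t
  have w: "(w has_real_derivative w' t) (at t within {0..T})" if t: "t \<in> {0..T}" for t
    unfolding w_def w'_def
    using DERIV_mult[OF has_real_derivative_inner_self[OF sol[OF t]] has_real_derivative_exp_integral[OF m(1) t, of "2 / \<epsilon>"]]
    by (rule DERIV_cong) (use \<open>\<epsilon> > 0\<close> in \<open>simp add: field_simps\<close>)
  have bound: "norm (u t) \<le> norm (u 0)" if t: "t \<in> {0..t0}" and small: "\<And>s. s \<in> {0..t} \<Longrightarrow> norm (u s) \<le> \<delta>" for t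
  proof -
    have "w t \<le> w 0"
    proof (rule derivative_nonpos_imp_le[where w = w and s = 0 and t = t and S = "{0..T}" and w' = w'])
      fix x assume "x \<in> {0<..<t}"
      then show "w' x \<le> 0"
        using coercive[of x "u x"] small[of x] t \<open>\<epsilon> > 0\<close>
        unfolding w'_def by (intro mult_nonneg_nonpos) auto
    qed (use t \<open>t0 \<le> T\<close> in \<open>auto intro!: w\<close>)
    moreover have "(norm (u t))\<^sup>2 * 1 \<le> w t"
      unfolding w_def using m(2)[OF t] \<open>\<epsilon> > 0\<close> by (intro mult_left_mono) auto
    moreover have "w 0 = (norm (u 0))\<^sup>2"
      by (simp add: w_def)
    ultimately have "(norm (u t))\<^sup>2 \<le> (norm (u 0))\<^sup>2"
      by linarith
    then show ?thesis
      by (rule power2_le_imp_le) simp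
  qed
  have "continuous_on {0..T} u"
    using sol by (meson continuous_on_eq_continuous_within has_vector_derivative_continuous)
  then have cont: "continuous_on {0..t0} (\<lambda>t. norm (u t))"
    using \<open>t0 \<le> T\<close> by (intro continuous_intros) (auto intro: continuous_on_subset)
  have less: "norm (u s) < \<delta>" if "s \<in> {0..t0}" for s
    using cont \<open>norm (u 0) < \<delta>\<close> order_le_less_trans[OF bound \<open>norm (u 0) < \<delta>\<close>] that
    by (rule continuous_bootstrap)
  show ?thesis
    using \<open>t \<in> {0..t0}\<close> by (intro bound) (auto intro!: less_imp_le less)
qed

text \<open>Moving away from 0 must be paid for in energy:
  \<open>c * norm x \<le> norm (f t x)\<close> makes
  \<open>h + \<kappa> * c / 2 * (norm u)\<^sup>2\<close> nonincreasing in the ball. The speed and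
  the dissipation both scale like \<open>1 / \<epsilon>\<close>, so the price of reaching radius
  \<delta> does not depend on \<epsilon>, and \<open>gap\<close> says that it cannot be
  afforded.\<close>

lemma energy_confines_solution:
  fixes f :: "real \<Rightarrow> 'a::real_inner \<Rightarrow> 'a"
  assumes "\<epsilon> > 0" "\<kappa> > 0" "c > 0" "{a..b} \<subseteq> {0..T}"
    and sol: "\<And>t. t \<in> {0..T} \<Longrightarrow> (u has_vector_derivative (- (1 / \<epsilon>)) *\<^sub>R f t (u t)) (at t within {0..T})"
    and h: "\<And>t. t \<in> {0..T} \<Longrightarrow> (h has_real_derivative h' t) (at t within {0..T})"
    and dissipation: "\<And>t. t \<in> {0..T} \<Longrightarrow> h' t \<le> - (\<kappa> / \<epsilon>) * (norm (f t (u t)))\<^sup>2"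
    and noncritical: "\<And>t x. t \<in> {a..b} \<Longrightarrow> norm x \<le> \<delta> \<Longrightarrow> c * norm x \<le> norm (f t x)"
    and "norm (u a) < \<delta>"
    and gap: "h a + \<kappa> * c / 2 * (norm (u a))\<^sup>2 < h b + \<kappa> * c / 2 * \<delta>\<^sup>2"
    and "t \<in> {a..b}"
  shows "norm (u t) < \<delta>"
proof -
  define w where "w t = h t + \<kappa> * c / 2 * (norm (u t))\<^sup>2" for t
  define w' where "w' t = h' t - \<kappa> * c / \<epsilon> * (u t \<bullet> f t (u t))" for t
  have w: "(w has_real_derivative w' t) (at t within {0..T})" if t: "t \<in> {0..T}" for t
    unfolding w_def w'_def
    using DERIV_add[OF h[OF t] DERIV_cmult[OF has_real_derivative_inner_self[OF sol[OF t]], of "\<kappa> * c / 2"]]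
    by (rule DERIV_cong) simp
  have "continuous_on {0..T} u"
    using sol by (meson continuous_on_eq_continuous_within has_vector_derivative_continuous)
  then have cont: "continuous_on {a..b} (\<lambda>t. norm (u t))"
    using \<open>{a..b} \<subseteq> {0..T}\<close> by (intro continuous_intros) (auto intro: continuous_on_subset)
  have "0 < \<delta>"
    using \<open>norm (u a) < \<delta>\<close> norm_ge_zero[of "u a"] by linarith
  show ?thesis
  proof (rule continuous_bootstrap[OF cont \<open>norm (u a) < \<delta>\<close> _ \<open>t \<in> {a..b}\<close>])
    fix t assume t: "t \<in> {a..b}" and small: "\<And>s. s \<in> {a..t} \<Longrightarrow> norm (u s) \<le> \<delta>"
    have "w t \<le> w a"
    proof (rule derivative_nonpos_imp_le[where w = w and s = a and t = t and S = "{0..T}" and w' = w'])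
      fix x assume x: "x \<in> {a<..<t}"
      then have xT: "x \<in> {a..b}" "x \<in> {0..T}" "x \<in> {a..t}"
        using t \<open>{a..b} \<subseteq> {0..T}\<close> by auto
      have "- c * (u x \<bullet> f x (u x)) \<le> c * norm (u x) * norm (f x (u x))"
        using Cauchy_Schwarz_ineq2[of "u x" "f x (u x)"] \<open>c > 0\<close>
          mult_left_mono[of "- (u x \<bullet> f x (u x))" "norm (u x) * norm (f x (u x))" c]
        by (simp add: abs_le_iff mult.assoc)
      also have "\<dots> \<le> norm (f x (u x)) * norm (f x (u x))"
        using noncritical[OF xT(1) small[OF xT(3)]] by (rule mult_right_mono) simp
      finally have "\<kappa> / \<epsilon> * (- c * (u x \<bullet> f x (u x))) \<le> \<kappa> / \<epsilon> * (norm (f x (u x)))\<^sup>2"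
        using \<open>\<kappa> > 0\<close> \<open>\<epsilon> > 0\<close> by (intro mult_left_mono) (simp_all add: power2_eq_square)
      with dissipation[OF xT(2)] show "w' x \<le> 0"
        by (simp add: w'_def algebra_simps)
    qed (use t \<open>{a..b} \<subseteq> {0..T}\<close> in \<open>auto intro!: w\<close>)
    \<comment> \<open>As \<open>h\<close> never increases, its drop up to \<open>t\<close> is at
      most its total drop up to \<open>b\<close>, which is what \<open>gap\<close> controls.\<close>
    moreover have "h b \<le> h t"
    proof (rule derivative_nonpos_imp_le[where w = h and s = t and t = b and S = "{0..T}" and w' = h'])
      fix x assume "x \<in> {t<..<b}"
      then have "x \<in> {0..T}"
        using t \<open>{a..b} \<subseteq> {0..T}\<close> by auto
      then show "h' x \<le> 0"
        using \<open>\<kappa> > 0\<close> \<open>\<epsilon> > 0\<close> by (intro order_trans[OF dissipation]) simp_all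
    qed (use t \<open>{a..b} \<subseteq> {0..T}\<close> in \<open>auto intro!: h\<close>)
    ultimately have "\<kappa> * c / 2 * (norm (u t))\<^sup>2 < \<kappa> * c / 2 * \<delta>\<^sup>2"
      using gap by (simp add: w_def)
    then have "(norm (u t))\<^sup>2 < \<delta>\<^sup>2"
      using \<open>\<kappa> > 0\<close> \<open>c > 0\<close> by simp
    then show "norm (u t) < \<delta>"
      using \<open>0 < \<delta>\<close> by (simp add: power2_less_imp_less)
  qed
qed

text \<open>
  Inside the cone where \<open>u \<bullet> e\<close> dominates, \<open>u \<bullet> e\<close> cannot shrink faster than
  \<open>exp (- (1 / \<epsilon>) \<integral>l)\<close>; the spectral gap \<open>g\<close> makes the cone invariant.
\<close>

lemma growth_along_eigenvector:
  fixes f :: "real \<Rightarrow> 'a::real_inner \<Rightarrow> 'a"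
  assumes "\<epsilon> > 0" "t1 \<le> T" "0 \<le> t1" and e: "norm e = 1"
    and sol: "\<And>t. t \<in> {0..T} \<Longrightarrow> (u has_vector_derivative (- (1 / \<epsilon>)) *\<^sub>R f t (u t)) (at t within {0..T})"
    and l: "continuous_on {0..T} l"
    and A: "\<And>t. linear (A t)" "\<And>t x y. t \<in> {0..t1} \<Longrightarrow> A t x \<bullet> y = A t y \<bullet> x"
    and Ae: "\<And>t. t \<in> {0..t1} \<Longrightarrow> A t e = l t *\<^sub>R e"
    and spectral_gap: "\<And>t y. t \<in> {0..t1} \<Longrightarrow> y \<bullet> e = 0 \<Longrightarrow> (l t + g) * (norm y)\<^sup>2 \<le> A t y \<bullet> y"
    and rem: "\<And>t x. t \<in> {0..t1} \<Longrightarrow> norm x \<le> \<delta> \<Longrightarrow> norm (f t x - A t x) \<le> \<eta> * norm x"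
    and small: "\<And>t. t \<in> {0..t1} \<Longrightarrow> norm (u t) \<le> \<delta>"
    and K: "K \<ge> 2" "(norm (u 0))\<^sup>2 \<le> K * (u 0 \<bullet> e)\<^sup>2"
    and \<eta>: "\<eta> \<ge> 0" "2 * (1 + K) * \<eta> \<le> g"
  shows "(u 0 \<bullet> e)\<^sup>2 \<le> \<delta>\<^sup>2 * exp (2 / \<epsilon> * (integral {0..t1} l + K * \<eta> * t1))"
proof -
  define R where "R t = f t (u t) - A t (u t)" for t
  have R: "\<bar>R t \<bullet> z\<bar> \<le> \<eta> * norm (u t) * norm z" if "t \<in> {0..t1}" for t z
    using rem[OF that small[OF that]] unfolding R_def[symmetric]
    by (intro order_trans[OF Cauchy_Schwarz_ineq2]) (simp add: mult_right_mono)
  have xu: "\<bar>u t \<bullet> e\<bar> \<le> norm (u t)" for t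
    using Cauchy_Schwarz_ineq2[of "u t" e] e by simp
  have xRe: "\<bar>(u t \<bullet> e) * (R t \<bullet> e)\<bar> \<le> \<eta> * (norm (u t))\<^sup>2" if t: "t \<in> {0..t1}" for t
  proof -
    have "\<bar>u t \<bullet> e\<bar> * \<bar>R t \<bullet> e\<bar> \<le> norm (u t) * (\<eta> * norm (u t))"
      using R[OF t, of e] xu[of t] e by (intro mult_mono) auto
    then show ?thesis
      by (simp add: abs_mult power2_eq_square mult.left_commute)
  qed
  have fe: "f t (u t) \<bullet> e = l t * (u t \<bullet> e) + R t \<bullet> e" if "t \<in> {0..t1}" for t
    using A(2)[OF that, of "u t" e] Ae[OF that] by (simp add: R_def inner_diff_left inner_commute[of _ "u t"])
  have fu: "l t * (norm (u t))\<^sup>2 + g * ((norm (u t))\<^sup>2 - (u t \<bullet> e)\<^sup>2) - \<eta> * (norm (u t))\<^sup>2 \<le> f t (u t) \<bullet> u t"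
    if t: "t \<in> {0..t1}" for t
  proof -
    \<comment> \<open>Orthogonal splitting along \<open>e\<close>. By symmetry and \<open>Ae\<close>
      the cross terms of the quadratic form vanish, so the spectral gap acts on \<open>y\<close>
      alone.\<close>
    define x where "x = u t \<bullet> e"
    define y where "y = u t - x *\<^sub>R e"
    have ye: "y \<bullet> e = 0"
      using e by (simp add: y_def x_def inner_diff_left norm_eq_1)
    have u: "u t = x *\<^sub>R e + y"
      by (simp add: y_def)
    have norm: "(norm (u t))\<^sup>2 = x\<^sup>2 + (norm y)\<^sup>2"
      using ye e unfolding u power2_norm_eq_inner
      by (simp add: inner_add_left inner_add_right inner_commute norm_eq_1 power2_eq_square)
    have "A t (u t) \<bullet> u t = l t * x\<^sup>2 + A t y \<bullet> y"
      unfolding u using A(1)[of t] A(2)[OF t, of y e] Ae[OF t] ye e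
      by (simp add: linear_add linear_cmul inner_add_left inner_add_right inner_commute norm_eq_1 power2_eq_square)
    moreover have "(l t + g) * (norm y)\<^sup>2 \<le> A t y \<bullet> y"
      using spectral_gap[OF t ye] .
    moreover have "- \<eta> * (norm (u t))\<^sup>2 \<le> R t \<bullet> u t"
      using R[OF t, of "u t"] by (simp add: power2_eq_square abs_le_iff)
    ultimately show ?thesis
      unfolding x_def[symmetric] using norm by (simp add: R_def inner_diff_left algebra_simps)
  qed
  have "((\<lambda>t. u t \<bullet> e) has_real_derivative (- (1 / \<epsilon>) * (f t (u t) \<bullet> e))) (at t within {0..T})" if "t \<in> {0..T}" for t
    using has_real_derivative_inner[OF sol[OF that] has_vector_derivative_const[of e]] by simp
  then have x2: "((\<lambda>t. (u t \<bullet> e)\<^sup>2) has_real_derivative (- (2 / \<epsilon>) * ((u t \<bullet> e) * (f t (u t) \<bullet> e)))) (at t within {0..T})"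
    if "t \<in> {0..T}" for t
    using that by (auto intro!: derivative_eq_intros)

  \<comment> \<open>\<open>w t \<le> 0\<close> says that \<open>u t\<close> lies in the cone. The
    exponential factor cancels the rate \<open>l t\<close> common to both squares, so that the sign
    of \<open>w'\<close> is decided by the gap \<open>g\<close> against the remainder.\<close>
  define w where "w t = ((norm (u t))\<^sup>2 - K * (u t \<bullet> e)\<^sup>2) * exp (2 / \<epsilon> * integral {0..t} l)" for t
  define w' where "w' t = 2 / \<epsilon> * exp (2 / \<epsilon> * integral {0..t} l) *
    (l t * ((norm (u t))\<^sup>2 - K * (u t \<bullet> e)\<^sup>2) - (f t (u t) \<bullet> u t - K * ((u t \<bullet> e) * (f t (u t) \<bullet> e))))" for t
  have w: "(w has_real_derivative w' t) (at t within {0..T})" if t: "t \<in> {0..T}" for t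
    unfolding w_def w'_def
    using DERIV_mult[OF DERIV_diff[OF has_real_derivative_inner_self[OF sol[OF t]] DERIV_cmult[OF x2[OF t], of K]]
        has_real_derivative_exp_integral[OF l t, of "2 / \<epsilon>"]]
    by (rule DERIV_cong) (use \<open>\<epsilon> > 0\<close> in \<open>simp add: field_simps inner_commute\<close>)
  have "w t \<le> 0" if "t \<in> {0..t1}" for t
  proof (rule nonpos_barrier[where S = "{0..T}" and w = w and w' = w' and a = 0 and b = t1])
    fix t assume t: "t \<in> {0..t1}" and "w t > 0"
    then have V: "K * (u t \<bullet> e)\<^sup>2 < (norm (u t))\<^sup>2"
      by (simp add: w_def zero_less_mult_iff)
    \<comment> \<open>Outside the cone \<open>K \<ge> 2\<close> makes the part orthogonal to
      \<open>e\<close> at least half of the squared norm, so the gap beats the total remainder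
      \<open>(1 + K) * \<eta> * (norm (u t))\<^sup>2\<close>.\<close>
    have "2 * (u t \<bullet> e)\<^sup>2 \<le> K * (u t \<bullet> e)\<^sup>2"
      using K by (intro mult_right_mono) auto
    then have "2 * (u t \<bullet> e)\<^sup>2 \<le> (norm (u t))\<^sup>2"
      using V by linarith
    then have "(norm (u t))\<^sup>2 \<le> 2 * ((norm (u t))\<^sup>2 - (u t \<bullet> e)\<^sup>2)"
      and x_le: "(u t \<bullet> e)\<^sup>2 \<le> (norm (u t))\<^sup>2"
      using zero_le_power2[of "u t \<bullet> e"] by argo+
    then have "(1 + K) * \<eta> * (norm (u t))\<^sup>2 \<le> (1 + K) * \<eta> * (2 * ((norm (u t))\<^sup>2 - (u t \<bullet> e)\<^sup>2))"
      using K \<eta> by (intro mult_left_mono) auto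
    also have "\<dots> = 2 * (1 + K) * \<eta> * ((norm (u t))\<^sup>2 - (u t \<bullet> e)\<^sup>2)"
      by (simp add: algebra_simps)
    also have "\<dots> \<le> g * ((norm (u t))\<^sup>2 - (u t \<bullet> e)\<^sup>2)"
      using \<eta> x_le by (intro mult_right_mono) auto
    finally have gap: "(1 + K) * \<eta> * (norm (u t))\<^sup>2 \<le> g * ((norm (u t))\<^sup>2 - (u t \<bullet> e)\<^sup>2)" .
    have "K * ((u t \<bullet> e) * (R t \<bullet> e)) \<le> K * (\<eta> * (norm (u t))\<^sup>2)"
      using xRe[OF t] K by (intro mult_left_mono) auto
    then have "l t * ((norm (u t))\<^sup>2 - K * (u t \<bullet> e)\<^sup>2) \<le> f t (u t) \<bullet> u t - K * ((u t \<bullet> e) * (f t (u t) \<bullet> e))"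
      using fu[OF t] gap unfolding fe[OF t] by (simp add: algebra_simps power2_eq_square)
    then show "w' t \<le> 0"
      using \<open>\<epsilon> > 0\<close> unfolding w'_def by (intro mult_nonneg_nonpos) auto
  qed (use that K \<open>t1 \<le> T\<close> in \<open>auto intro!: w simp: w_def\<close>)
  then have cone: "(norm (u t))\<^sup>2 \<le> K * (u t \<bullet> e)\<^sup>2" if "t \<in> {0..t1}" for t
    using that by (simp add: w_def mult_le_0_iff not_le)

  \<comment> \<open>Inside the cone the remainder is at most
    \<open>K * \<eta> * (u t \<bullet> e)\<^sup>2\<close>, hence the rate
    \<open>l s + K * \<eta>\<close>. The minus sign turns growth into the decrease that
    \<open>derivative_nonpos_imp_le\<close> handles.\<close>
  define q where "q t = - ((u t \<bullet> e)\<^sup>2 * exp (2 / \<epsilon> * integral {0..t} (\<lambda>s. l s + K * \<eta>)))" for t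
  define q' where "q' t = - (2 / \<epsilon> * exp (2 / \<epsilon> * integral {0..t} (\<lambda>s. l s + K * \<eta>)) *
    ((l t + K * \<eta>) * (u t \<bullet> e)\<^sup>2 - (u t \<bullet> e) * (f t (u t) \<bullet> e)))" for t
  have l': "continuous_on {0..T} (\<lambda>s. l s + K * \<eta>)"
    using l by (intro continuous_intros)
  have q: "(q has_real_derivative q' t) (at t within {0..T})" if t: "t \<in> {0..T}" for t
    unfolding q_def q'_def
    using DERIV_minus[OF DERIV_mult[OF x2[OF t] has_real_derivative_exp_integral[OF l' t, of "2 / \<epsilon>"]]]
    by (rule DERIV_cong) (use \<open>\<epsilon> > 0\<close> in \<open>simp_all add: field_simps\<close>)
  have "q t1 \<le> q 0"
  proof (rule derivative_nonpos_imp_le[where w = q and s = 0 and t = t1 and S = "{0..T}" and w' = q'])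
    fix t assume "t \<in> {0<..<t1}"
    then have t: "t \<in> {0..t1}"
      by simp
    have "(u t \<bullet> e) * (R t \<bullet> e) \<le> \<eta> * (norm (u t))\<^sup>2"
      using xRe[OF t] by simp
    also have "\<dots> \<le> \<eta> * (K * (u t \<bullet> e)\<^sup>2)"
      using cone[OF t] \<eta> by (intro mult_left_mono)
    finally have "(u t \<bullet> e) * (f t (u t) \<bullet> e) \<le> (l t + K * \<eta>) * (u t \<bullet> e)\<^sup>2"
      unfolding fe[OF t] by (simp add: algebra_simps power2_eq_square)
    then show "q' t \<le> 0"
      using \<open>\<epsilon> > 0\<close> by (simp add: q'_def)
  qed (use \<open>t1 \<le> T\<close> \<open>0 \<le> t1\<close> in \<open>auto intro!: q\<close>)
  then have "(u 0 \<bullet> e)\<^sup>2 \<le> (u t1 \<bullet> e)\<^sup>2 * exp (2 / \<epsilon> * integral {0..t1} (\<lambda>s. l s + K * \<eta>))"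
    by (simp add: q_def)
  also have "integral {0..t1} (\<lambda>s. l s + K * \<eta>) = integral {0..t1} l + K * \<eta> * t1"
    using continuous_on_subset[OF l, of "{0..t1}"] \<open>t1 \<le> T\<close> \<open>0 \<le> t1\<close>
    by (subst integral_add) (auto intro!: integrable_continuous_real)
  also have "(u t1 \<bullet> e)\<^sup>2 \<le> \<delta>\<^sup>2"
    using xu[of t1] small[of t1] \<open>0 \<le> t1\<close> by (intro abs_le_square_iff[THEN iffD1]) auto
  finally show ?thesis
    by (simp add: mult_right_mono)
qed

section \<open>Spectral and energy bounds\<close>

text \<open>\<open>exp (- \<mu> / x)\<close> tends to 0 faster than any power of \<open>x\<close> as
  \<open>x\<close> tends to 0 from the right. This yields the final contradiction with the lower
  bound on the initial data.\<close>

lemma powr_not_eventually_le_exp_inverse: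
  fixes \<epsilon> :: "nat \<Rightarrow> real"
  assumes "\<And>k. \<epsilon> k > 0" "\<epsilon> \<longlonglongrightarrow> 0" "\<mu> > 0" "c > 0"
  shows "\<not> (\<forall>\<^sub>F k in sequentially. c * \<epsilon> k powr a \<le> M * exp (- \<mu> / \<epsilon> k))"
proof
  assume ev: "\<forall>\<^sub>F k in sequentially. c * \<epsilon> k powr a \<le> M * exp (- \<mu> / \<epsilon> k)"
  have "filterlim \<epsilon> (at_right 0) sequentially"
    using assms(1,2) by (auto simp: filterlim_at less_imp_neq[symmetric] intro!: always_eventually)
  moreover have "((\<lambda>x. M * exp (- \<mu> / x) * x powr (- a)) \<longlongrightarrow> 0) (at_right 0)"
    using \<open>\<mu> > 0\<close> by real_asymp
  ultimately have "(\<lambda>k. M * exp (- \<mu> / \<epsilon> k) * \<epsilon> k powr (- a)) \<longlonglongrightarrow> 0"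
    by (rule filterlim_compose[rotated])
  moreover have "\<forall>\<^sub>F k in sequentially. c \<le> M * exp (- \<mu> / \<epsilon> k) * \<epsilon> k powr (- a)"
    using ev
  proof eventually_elim
    case (elim k)
    then show ?case
      using assms(1)[of k] by (simp add: powr_minus field_simps)
  qed
  ultimately have "c \<le> 0"
    by (rule tendsto_lowerbound) simp
  with \<open>c > 0\<close> show False
    by simp
qed

text \<open>Near 0 the integral lies above a line of slope \<open>l 0 / 2\<close>, so its zeros in
  \<open>{0<..<T}\<close> stay away from 0 and form part of a compact set, nonempty because the
  integral ends negative; thus the \<open>LEAST\<close> is attained. The linear lower bound leaves
  room to lower \<open>l\<close> by \<eta> with the integral still nonnegative.\<close>

lemma first_zero_of_integral:
  fixes l :: "real \<Rightarrow> real"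
  assumes l: "continuous_on {0..T} l" and "T > 0" "l 0 > 0" "integral {0..T} l < 0"
  defines "z \<equiv> (LEAST t. t \<in> {0<..<T} \<and> integral {0..t} l = 0)"
  shows "0 < z" "z < T" "integral {0..z} l = 0"
    and "t0 < z \<Longrightarrow> \<exists>\<eta>>0. \<forall>t\<in>{0..t0}. \<eta> * t \<le> integral {0..t} l"
proof -
  let ?L = "\<lambda>t. integral {0..t} l"
  have L: "continuous_on {0..T} ?L"
    using l by (intro indefinite_integral_continuous_1 integrable_continuous_real)
  have "\<forall>\<^sub>F s in at 0 within {0..T}. l s > l 0 / 2"
    using l \<open>l 0 > 0\<close> \<open>T > 0\<close> by (intro order_tendstoD(1)[of _ "l 0"]) (auto simp: continuous_on_def)
  then obtain d where d: "d > 0" "\<And>s. s \<in> {0..T} \<Longrightarrow> s < d \<Longrightarrow> s \<noteq> 0 \<Longrightarrow> l s > l 0 / 2"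
    by (auto simp: eventually_at dist_real_def)
  define b where "b = min d T / 2"
  have b: "0 < b" "b < T" "b < d"
    using d \<open>T > 0\<close> by (auto simp: b_def)
  have near: "l 0 / 2 * t \<le> ?L t" if "t \<in> {0..b}" for t
  proof -
    have "integral {0..t} (\<lambda>_. l 0 / 2) \<le> ?L t"
    proof (rule integral_le)
      show "l integrable_on {0..t}"
        using that b by (intro integrable_continuous_real continuous_on_subset[OF l]) auto
      fix x assume x: "x \<in> {0..t}"
      then show "l 0 / 2 \<le> l x"
        using d(2)[of x] that b \<open>l 0 > 0\<close> by (cases "x = 0") auto
    qed auto
    then show ?thesis
      using that by (simp add: mult.commute)
  qed
  define N where "N = {b..T} \<inter> ?L -` {0}"
  have zero: "\<exists>x\<ge>b. x \<le> t \<and> ?L x = 0" if "t \<in> {b..T}" "?L t \<le> 0" for t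
  proof (rule IVT2')
    show "0 \<le> ?L b"
      using b \<open>l 0 > 0\<close> by (intro order_trans[OF _ near]) auto
  qed (use that b in \<open>auto intro: continuous_on_subset[OF L]\<close>)
  have "compact N"
  proof -
    have "closed N"
      unfolding N_def using b by (intro continuous_closed_preimage continuous_on_subset[OF L]) auto
    then show ?thesis
      by (metis N_def bounded_Int bounded_closed_interval compact_eq_bounded_closed box_real(2))
  qed
  moreover have "N \<noteq> {}"
    using zero[of T] b \<open>?L T < 0\<close> by (auto simp: N_def)
  ultimately obtain s where s: "s \<in> N" "\<And>x. x \<in> N \<Longrightarrow> s \<le> x"
    using compact_attains_inf[of N] by auto
  have "s < T"
    using s(1) \<open>?L T < 0\<close> by (cases "s = T") (auto simp: N_def)
  have "z = s"
    unfolding z_def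
  proof (rule Least_equality)
    show "s \<in> {0<..<T} \<and> ?L s = 0"
      using s(1) b \<open>s < T\<close> by (simp add: N_def)
    fix t assume t: "t \<in> {0<..<T} \<and> ?L t = 0"
    then have "b < t"
      using near[of t] \<open>l 0 > 0\<close> by (force simp: mult_le_0_iff not_le)
    with t show "s \<le> t"
      by (intro s) (auto simp: N_def)
  qed
  then show "0 < z" "z < T" "?L z = 0"
    using s(1) \<open>s < T\<close> b by (auto simp: N_def)
  assume "t0 < z"
  show "\<exists>\<eta>>0. \<forall>t\<in>{0..t0}. \<eta> * t \<le> ?L t"
  proof (cases "t0 \<le> b")
    case True
    then show ?thesis
      using near \<open>l 0 > 0\<close> by (intro exI[of _ "l 0 / 2"]) auto
  next
    case False
    have "\<exists>x\<in>{b..t0}. \<forall>y\<in>{b..t0}. ?L x \<le> ?L y"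
      using False b \<open>t0 < z\<close> \<open>z < T\<close>
      by (intro continuous_attains_inf continuous_on_subset[OF L]) auto
    then obtain x where x: "x \<in> {b..t0}" "\<And>y. y \<in> {b..t0} \<Longrightarrow> ?L x \<le> ?L y"
      by blast
    have "?L x > 0"
    proof (rule ccontr)
      assume "\<not> ?L x > 0"
      then obtain y where "y \<ge> b" "y \<le> x" "?L y = 0"
        using zero[of x] x(1) \<open>t0 < z\<close> \<open>z < T\<close> by auto
      then have "s \<le> y"
        using x(1) \<open>t0 < z\<close> \<open>z < T\<close> by (intro s) (auto simp: N_def)
      with \<open>y \<le> x\<close> x(1) \<open>t0 < z\<close> \<open>z = s\<close> show False
        by simp
    qed
    \<comment> \<open>The first term handles times up to \<open>b\<close>. The second handles the
      rest, because \<open>t \<le> T\<close> and \<open>?L x\<close> is the minimum of the integral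
      over \<open>{b..t0}\<close>.\<close>
    define \<eta> where "\<eta> = min (l 0 / 2) (?L x / T)"
    have "\<eta> * t \<le> ?L t" if t: "t \<in> {0..t0}" for t
    proof (cases "t \<le> b")
      case True
      then have "\<eta> * t \<le> l 0 / 2 * t"
        using t by (intro mult_right_mono) (simp_all only: \<eta>_def min.cobounded1 atLeastAtMost_iff)
      also have "\<dots> \<le> ?L t"
        using True t by (intro near) auto
      finally show ?thesis .
    next
      case False
      have "\<eta> * t \<le> ?L x / T * T"
        using t \<open>?L x > 0\<close> \<open>t0 < z\<close> \<open>z < T\<close> \<open>T > 0\<close> by (intro mult_mono) (auto simp: \<eta>_def)
      also have "\<dots> \<le> ?L t"
        using False t x(2)[of t] \<open>T > 0\<close> by simp
      finally show ?thesis .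
    qed
    moreover have "\<eta> > 0"
      using \<open>l 0 > 0\<close> \<open>?L x > 0\<close> \<open>T > 0\<close> by (simp add: \<eta>_def)
    ultimately show ?thesis
      by blast
  qed
qed

text \<open>The minimum eigenvalue is 1-Lipschitz in the operator norm: test the quadratic form of
  \<open>B t\<close> with a unit minimal eigenvector of \<open>B s\<close>, then exchange the roles
  of \<open>s\<close> and \<open>t\<close>.\<close>

lemma continuous_on_min_eigenvalue:
  fixes B :: "'b::metric_space \<Rightarrow> 'a::euclidean_space \<Rightarrow>\<^sub>L 'a"
  assumes B: "continuous_on S B"
    and sym: "\<And>t x y. t \<in> S \<Longrightarrow> B t x \<bullet> y = B t y \<bullet> x"
  shows "continuous_on S (\<lambda>t. min_eigenvalue (B t))"
proof -
  have le: "min_eigenvalue (B t) - min_eigenvalue (B s) \<le> dist (B t) (B s)" if "t \<in> S" "s \<in> S" for s t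
  proof -
    have lin: "linear (blinfun_apply (B t))" for t
      by (rule bounded_linear.linear[OF blinfun.bounded_linear_right])
    obtain v where v: "norm v = 1" "B s v = min_eigenvalue (B s) *\<^sub>R v"
      using min_eigenvalue_self_adjoint(3)[OF lin sym[OF \<open>s \<in> S\<close>]] by blast
    have "min_eigenvalue (B t) * (norm v)\<^sup>2 \<le> B t v \<bullet> v"
      using min_eigenvalue_self_adjoint(1)[OF lin sym[OF \<open>t \<in> S\<close>]] by blast
    also have "\<dots> = B s v \<bullet> v + (B t - B s) v \<bullet> v"
      by (simp add: blinfun.diff_left inner_diff_left)
    also have "(B t - B s) v \<bullet> v \<le> norm ((B t - B s) v) * norm v"
      by (rule norm_cauchy_schwarz)
    also have "\<dots> \<le> dist (B t) (B s)"
      using norm_blinfun[of "B t - B s" v] v by (simp add: dist_norm)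
    finally show ?thesis
      using v by (simp add: norm_eq_1)
  qed
  then have "dist (min_eigenvalue (B t)) (min_eigenvalue (B s)) \<le> dist (B t) (B s)" if "t \<in> S" "s \<in> S" for s t
    using that le[of t s] le[of s t] by (simp add: dist_real_def dist_commute abs_le_iff)
  then show ?thesis
    using B unfolding continuous_on_iff by (meson order_le_less_trans)
qed

text \<open>The excess of the form over the minimum eigenvalue is continuous on the compact set of
  times and unit vectors orthogonal to \<open>e\<close>. It is positive there, since equality would
  make \<open>y\<close> a minimal eigenvector, hence a multiple of \<open>e\<close>. Its minimum
  serves as \<open>g\<close>.\<close>

lemma uniform_spectral_gap:
  fixes B :: "real \<Rightarrow> 'a::euclidean_space \<Rightarrow>\<^sub>L 'a"
  assumes B: "continuous_on {0..b} B"
    and sym: "\<And>t x y. t \<in> {0..b} \<Longrightarrow> B t x \<bullet> y = B t y \<bullet> x"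
    and eig: "\<And>t. t \<in> {0..b} \<Longrightarrow> eigenspace (B t) (min_eigenvalue (B t)) = span {e}"
  obtains g where "g > 0"
    "\<And>t y. t \<in> {0..b} \<Longrightarrow> y \<bullet> e = 0 \<Longrightarrow> (min_eigenvalue (B t) + g) * (norm y)\<^sup>2 \<le> B t y \<bullet> y"
proof -
  let ?l = "\<lambda>t. min_eigenvalue (B t)"
  have lin: "linear (blinfun_apply (B t))" for t
    by (rule bounded_linear.linear[OF blinfun.bounded_linear_right])
  define S where "S = {0..b} \<times> (sphere 0 1 \<inter> {y. e \<bullet> y = 0})"
  have "compact S"
    unfolding S_def by (intro compact_Times compact_Int_closed closed_hyperplane) auto
  have "\<exists>g>0. \<forall>(t, y)\<in>S. ?l t + g \<le> B t y \<bullet> y"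
  proof (cases "S = {}")
    \<comment> \<open>This occurs for instance when the space is a line spanned by \<open>e\<close>;
      any positive \<open>g\<close> then works.\<close>
    case True
    then show ?thesis
      by (intro exI[of _ 1]) auto
  next
    case False
    have "continuous_on S (\<lambda>z. B (fst z) (snd z) \<bullet> snd z - ?l (fst z))"
      using continuous_on_min_eigenvalue[OF B sym] B
      by (intro continuous_intros continuous_on_compose2[of "{0..b}" _ S fst]) (auto simp: S_def)
    then obtain z where z: "z \<in> S"
      "\<And>w. w \<in> S \<Longrightarrow> B (fst z) (snd z) \<bullet> snd z - ?l (fst z) \<le> B (fst w) (snd w) \<bullet> snd w - ?l (fst w)"
      using continuous_attains_inf[OF \<open>compact S\<close> False] by blast
    obtain t y where ty: "z = (t, y)" "t \<in> {0..b}" "norm y = 1" "e \<bullet> y = 0"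
      using z(1) by (auto simp: S_def)
    have "?l t \<noteq> B t y \<bullet> y"
    proof
      assume "?l t = B t y \<bullet> y"
      then have "B t y = ?l t *\<^sub>R y"
        using min_eigenvalue_self_adjoint(2)[OF lin sym[OF ty(2)], of y] ty(3) by simp
      then have "y \<in> span {e}"
        using eig[OF ty(2)] by (auto simp: eigenspace_def)
      then obtain c where "y = c *\<^sub>R e"
        by (auto simp: span_singleton)
      then have "y \<bullet> y = 0"
        using ty(4) by (metis inner_scaleR_left mult_zero_right)
      with ty(3) show False
        by (simp add: norm_eq_1)
    qed
    moreover have "?l t \<le> B t y \<bullet> y"
      using min_eigenvalue_self_adjoint(1)[OF lin sym[OF ty(2)], of y] ty(3) by simp
    ultimately show ?thesis
      using z(2) unfolding ty(1) by (intro exI[of _ "B t y \<bullet> y - ?l t"]) force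
  qed
  then obtain g where g: "g > 0" "\<And>t y. (t, y) \<in> S \<Longrightarrow> ?l t + g \<le> B t y \<bullet> y"
    by blast
  have "(?l t + g) * (norm y)\<^sup>2 \<le> B t y \<bullet> y" if "t \<in> {0..b}" "y \<bullet> e = 0" for t y
  proof (cases "y = 0")
    case False
    then have "?l t + g \<le> B t (y /\<^sub>R norm y) \<bullet> (y /\<^sub>R norm y)"
      using that by (intro g(2)) (simp add: S_def inner_commute)
    also have "\<dots> = (B t y \<bullet> y) / (norm y)\<^sup>2"
      by (simp add: blinfun.scaleR_right power2_eq_square field_simps)
    finally show ?thesis
      using False by (simp add: field_simps)
  qed simp
  with g(1) show thesis
    by (rule that)
qed

text \<open>By (F2) the explicit time dependence raises the energy at a rate of at most
  \<open>C1 * (F + C2 / C1)\<close>. The weight \<open>exp (- C1 * t)\<close> absorbs this and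
  leaves only the gradient term, with weight at least \<open>exp (- C1 * T)\<close>. Neither
  \<open>G\<close> nor \<kappa> depends on \<epsilon> or on the solution.\<close>

lemma energy_dissipation:
  fixes F :: "real \<Rightarrow> 'a::euclidean_space \<Rightarrow> real"
  assumes "F0 T F" "F2 T F" "T > 0"
  obtains \<kappa> G where "\<kappa> > 0" "continuous_on ({0..T} \<times> UNIV) (\<lambda>(t, x). G t x)"
    "\<And>\<epsilon> u t. \<epsilon> > 0 \<Longrightarrow> t \<in> {0..T} \<Longrightarrow>
      (u has_vector_derivative (- (1 / \<epsilon>)) *\<^sub>R gradient (F t) (u t)) (at t within {0..T}) \<Longrightarrow>
      \<exists>h'. ((\<lambda>s. G s (u s)) has_real_derivative h') (at t within {0..T}) \<and>
        h' \<le> - (\<kappa> / \<epsilon>) * (norm (gradient (F t) (u t)))\<^sup>2"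
proof -
  obtain C1 C2 where C: "C1 > 0" "C2 > 0"
    "\<And>t x. t \<in> {0..T} \<Longrightarrow> \<bar>vector_derivative (\<lambda>s. F s x) (at t within {0..T})\<bar> \<le> C1 * F t x + C2"
    using \<open>F2 T F\<close> unfolding F2_def by blast
  define G where "G t x = (F t x + C2 / C1) * exp (- C1 * t)" for t x
  define \<kappa> where "\<kappa> = exp (- C1 * T)"
  have "continuous_on ({0..T} \<times> UNIV) (\<lambda>z. ((case z of (t, x) \<Rightarrow> F t x) + C2 / C1) * exp (- C1 * fst z))"
    by (intro continuous_on_mult continuous_on_add F0_continuous_on[OF \<open>F0 T F\<close>])
      (auto intro!: continuous_intros)
  then have cont: "continuous_on ({0..T} \<times> UNIV) (\<lambda>(t, x). G t x)"
    by (simp add: G_def case_prod_unfold)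
  have "\<exists>h'. ((\<lambda>s. G s (u s)) has_real_derivative h') (at t within {0..T}) \<and>
        h' \<le> - (\<kappa> / \<epsilon>) * (norm (gradient (F t) (u t)))\<^sup>2"
    if "\<epsilon> > 0" "t \<in> {0..T}"
      and u: "(u has_vector_derivative (- (1 / \<epsilon>)) *\<^sub>R gradient (F t) (u t)) (at t within {0..T})"
    for \<epsilon> u t
  proof (intro exI conjI)
    let ?D = "vector_derivative (\<lambda>s. F s (u t)) (at t within {0..T})"
    let ?n = "(norm (gradient (F t) (u t)))\<^sup>2"
    have "((\<lambda>s. F s (u s)) has_real_derivative ?D - ?n / \<epsilon>) (at t within {0..T})"
      using F0_chain_rule[OF \<open>F0 T F\<close> \<open>T > 0\<close> \<open>t \<in> {0..T}\<close> u] by (simp add: power2_norm_eq_inner)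
    then show "((\<lambda>s. G s (u s)) has_real_derivative
        (?D - ?n / \<epsilon> - (C1 * F t (u t) + C2)) * exp (- C1 * t)) (at t within {0..T})"
      unfolding G_def using C(1)
      by (auto intro!: derivative_eq_intros simp: field_simps)
    have "(?D - ?n / \<epsilon> - (C1 * F t (u t) + C2)) * exp (- C1 * t) \<le> (- (?n / \<epsilon>)) * exp (- C1 * t)"
      using C(3)[OF \<open>t \<in> {0..T}\<close>, of "u t"] by (intro mult_right_mono) auto
    also have "\<dots> \<le> (- (?n / \<epsilon>)) * \<kappa>"
      unfolding \<kappa>_def using \<open>\<epsilon> > 0\<close> \<open>t \<in> {0..T}\<close> C(1) by (intro mult_left_mono_neg) auto
    also have "\<dots> = - (\<kappa> / \<epsilon>) * ?n"
      by simp
    finally show "(?D - ?n / \<epsilon> - (C1 * F t (u t) + C2)) * exp (- C1 * t) \<le> - (\<kappa> / \<epsilon>) * ?n" .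
  qed
  with cont show thesis
    by (intro that[of \<kappa> G]) (auto simp: \<kappa>_def)
qed

text \<open>Injectivity gives \<open>norm (B s x) \<ge> c * norm x\<close>. Moving the time from
  \<open>s\<close> to \<open>t\<close> and replacing the linear map by \<open>f\<close> each cost at
  most a third of this, so a third remains.\<close>

lemma norm_lower_bound_near_nondegenerate:
  fixes f :: "real \<Rightarrow> 'a::euclidean_space \<Rightarrow> 'a"
  assumes B: "continuous_on {0..T} B" and s: "s \<in> {0<..<T}"
    and inj: "\<And>v. blinfun_apply (B s) v = 0 \<Longrightarrow> v = 0"
    and lin: "\<And>\<eta>. \<eta> > 0 \<Longrightarrow> \<exists>\<delta>>0. \<forall>t\<in>{0..T}. \<forall>x. norm x \<le> \<delta> \<longrightarrow> norm (f t x - B t x) \<le> \<eta> * norm x"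
  obtains c \<delta> \<sigma> where "c > 0" "\<delta> > 0" "\<sigma> > 0" "{s - \<sigma>..s + \<sigma>} \<subseteq> {0..T}"
    "\<And>t x. t \<in> {s - \<sigma>..s + \<sigma>} \<Longrightarrow> norm x \<le> \<delta> \<Longrightarrow> c * norm x \<le> norm (f t x)"
proof -
  have "linear (blinfun_apply (B s))"
    by (rule bounded_linear.linear[OF blinfun.bounded_linear_right])
  moreover from this have "inj (blinfun_apply (B s))"
    using inj by (simp add: linear_injective_0)
  ultimately obtain c where c: "c > 0" "\<And>x. c * norm x \<le> norm (B s x)"
    using linear_inj_bounded_below_pos by blast
  obtain d where d: "d > 0" "\<And>t. t \<in> {0..T} \<Longrightarrow> dist t s < d \<Longrightarrow> dist (B t) (B s) < c / 3"
    using B s c(1) unfolding continuous_on_iff by (metis divide_pos_pos greaterThanLessThan_iff less_imp_le atLeastAtMost_iff zero_less_numeral)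
  obtain \<delta> where \<delta>: "\<delta> > 0" "\<And>t x. t \<in> {0..T} \<Longrightarrow> norm x \<le> \<delta> \<Longrightarrow> norm (f t x - B t x) \<le> c / 3 * norm x"
    using lin[of "c / 3"] c(1) by auto
  define \<sigma> where "\<sigma> = min (d / 2) (min s (T - s))"
  have \<sigma>: "\<sigma> > 0" "{s - \<sigma>..s + \<sigma>} \<subseteq> {0..T}" "\<sigma> < d"
    using d s by (auto simp: \<sigma>_def)
  have "c / 3 * norm x \<le> norm (f t x)" if t: "t \<in> {s - \<sigma>..s + \<sigma>}" and x: "norm x \<le> \<delta>" for t x
  proof -
    have "t \<in> {0..T}" "dist t s < d"
      using t \<sigma> by (auto simp: dist_real_def)
    then have "norm ((B t - B s) x) \<le> c / 3 * norm x"
      using d(2)[of t]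
      by (intro order_trans[OF norm_blinfun] mult_right_mono) (simp_all add: dist_norm)
    moreover have "norm (f t x - B t x) \<le> c / 3 * norm x"
      using \<delta>(2)[OF \<open>t \<in> {0..T}\<close> x] .
    moreover have "norm (B s x) \<le> norm (f t x) + norm (f t x - B t x) + norm ((B t - B s) x)"
    proof -
      have eq: "B s x = f t x - (f t x - B t x) - (B t - B s) x"
        by (simp add: blinfun.diff_left)
      show ?thesis
        by (subst eq) (intro order_trans[OF norm_triangle_ineq4] add_mono norm_triangle_ineq4 order_refl)
    qed
    ultimately show ?thesis
      using c(2)[of x] by simp
  qed
  with c \<delta> \<sigma> show thesis
    by (intro that[of "c / 3" \<delta> \<sigma>]) auto
qed

section \<open>The first jump\<close>

lemma liminf_positive_subseq_bound:
  fixes g :: "nat \<Rightarrow> real"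
  assumes "liminf (\<lambda>k. ereal (g k)) > 0" "strict_mono r"
  obtains c where "c > 0" "\<forall>\<^sub>F k in sequentially. c < g (r k)"
proof -
  obtain c where c: "0 < ereal c" "ereal c < liminf (\<lambda>k. ereal (g k))"
    using assms(1) ereal_dense2 by blast
  have "\<forall>\<^sub>F k in sequentially. c < g (r k)"
    using eventually_subseq[OF assms(2) less_LiminfD[OF c(2)]] by simp
  with c(1) show thesis
    by (intro that) simp_all
qed

theorem theorem3p4:
  fixes T :: real
    and F :: "real \<Rightarrow> 'a::euclidean_space \<Rightarrow> real"
    and A :: "real \<Rightarrow> 'a \<Rightarrow> 'a"
    and lam1 :: "real \<Rightarrow> real"
    and tstar :: real
    and e1 :: 'a
    and \<epsilon> :: "nat \<Rightarrow> real"
    and u\<epsilon> :: "nat \<Rightarrow> real \<Rightarrow> 'a"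
    and r :: "nat \<Rightarrow> nat"
    and u :: "real \<Rightarrow> 'a"
  defines "A \<equiv> \<lambda>t. hessian (F t) 0"
    and "lam1 \<equiv> \<lambda>t. min_eigenvalue (A t)"
    and "tstar \<equiv> (LEAST t. t \<in> {0<..<T} \<and> integral {0..t} lam1 = 0)"
  assumes "T > 0"
    and "F0 T F" and "F1 T F" and "F2 T F" and "F3 T F"
    and "\<forall>t\<in>{0..T}. gradient (F t) 0 = 0"
    and "lam1 0 > 0"
    and "integral {0..T} lam1 < 0"
    and A1: "\<exists>\<rho>>0. {0..tstar + \<rho>} \<subseteq> {0..T} \<and>
           (\<forall>t\<in>{0..tstar + \<rho>}. simple_eigenvalue (A t) (lam1 t) \<and>
              eigenspace (A t) (lam1 t) = span {e1})"
    and A2: "det_op (A tstar) \<noteq> 0"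
    and "\<forall>k. \<epsilon> k > 0" and "\<epsilon> \<longlonglongrightarrow> 0"
    and "\<forall>k. is_solution T F (\<epsilon> k) (u\<epsilon> k)"
    and "(\<lambda>k. u\<epsilon> k 0) \<longlonglongrightarrow> 0"
    and "\<exists>\<alpha>>0. liminf (\<lambda>k. ereal (norm (u\<epsilon> k 0) / \<epsilon> k powr \<alpha>)) > 0"
    and "liminf (\<lambda>k. ereal (\<bar>u\<epsilon> k 0 \<bullet> e1\<bar>\<^sup>2 / (norm (u\<epsilon> k 0))\<^sup>2)) > 0"
    and "strict_mono r"
    and "\<forall>t\<in>{0..T}. (\<lambda>k. u\<epsilon> (r k) t) \<longlonglongrightarrow> u t"
    and "limit_evolution T F u"
  shows "tstar \<in> jump_set T u \<and> (\<forall>t\<in>jump_set T u. tstar \<le> t)"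
proof -

  \<comment> \<open>The subsequence and the Hessian at the origin\<close>
  define f where "f t = gradient (F t)" for t
  define L where "L t = integral {0..t} lam1" for t
  define v where "v k = u\<epsilon> (r k)" for k
  define \<epsilon>' where "\<epsilon>' k = \<epsilon> (r k)" for k
  have \<epsilon>': "\<epsilon>' k > 0" for k
    using \<open>\<forall>k. \<epsilon> k > 0\<close> by (simp add: \<epsilon>'_def)
  have \<epsilon>'_lim: "\<epsilon>' \<longlonglongrightarrow> 0"
    using LIMSEQ_subseq_LIMSEQ[OF \<open>\<epsilon> \<longlonglongrightarrow> 0\<close> \<open>strict_mono r\<close>] by (simp add: \<epsilon>'_def[abs_def] o_def)
  have v0: "(\<lambda>k. v k 0) \<longlonglongrightarrow> 0"
    using LIMSEQ_subseq_LIMSEQ[OF \<open>(\<lambda>k. u\<epsilon> k 0) \<longlonglongrightarrow> 0\<close> \<open>strict_mono r\<close>] by (simp add: v_def o_def)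
  have v_lim: "(\<lambda>k. v k t) \<longlonglongrightarrow> u t" if "t \<in> {0..T}" for t
    using that \<open>\<forall>t\<in>{0..T}. (\<lambda>k. u\<epsilon> (r k) t) \<longlonglongrightarrow> u t\<close> by (simp add: v_def)
  have sol: "(v k has_vector_derivative (- (1 / \<epsilon>' k)) *\<^sub>R f t (v k t)) (at t within {0..T})" if t: "t \<in> {0..T}" for k t
  proof -
    obtain w where w: "(v k has_vector_derivative w) (at t within {0..T})" "\<epsilon>' k *\<^sub>R w = - f t (v k t)"
      using \<open>\<forall>k. is_solution T F (\<epsilon> k) (u\<epsilon> k)\<close> t unfolding is_solution_def v_def \<epsilon>'_def f_def by metis
    have "w = (1 / \<epsilon>' k) *\<^sub>R (\<epsilon>' k *\<^sub>R w)"
      using \<epsilon>'[of k] by simp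
    then have "w = (- (1 / \<epsilon>' k)) *\<^sub>R f t (v k t)"
      unfolding w(2) by simp
    with w(1) show ?thesis
      by simp
  qed

  obtain B :: "real \<times> 'a \<Rightarrow> 'a \<Rightarrow>\<^sub>L 'a" where B: "continuous_on ({0..T} \<times> UNIV) B"
    "\<And>t x. t \<in> {0..T} \<Longrightarrow> GDERIV (F t) x :> f t x"
    "\<And>t x. t \<in> {0..T} \<Longrightarrow> (f t has_derivative B (t, x)) (at x)"
    using F0_obtain_hessian[OF \<open>F0 T F\<close>] unfolding f_def by metis
  define H where "H t = B (t, 0)" for t
  have AH: "A t = blinfun_apply (H t)" if "t \<in> {0..T}" for t
    using frechet_derivative_at[OF B(3)[OF that, of 0]] by (simp add: A_def hessian_def f_def H_def)
  have lam1: "lam1 t = min_eigenvalue (blinfun_apply (H t))" if "t \<in> {0..T}" for t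
    using AH[OF that] by (simp add: lam1_def)
  have lin_H: "linear (blinfun_apply (H t))" for t
    by (rule bounded_linear.linear[OF blinfun.bounded_linear_right])
  have sym: "H t x \<bullet> y = H t y \<bullet> x" if "t \<in> {0..T}" for t x y
    unfolding H_def using B(2,3)[OF that] by (rule second_derivative_symmetric)
  have H_cont: "continuous_on {0..T} H"
    unfolding H_def by (rule continuous_on_compose2[OF B(1)]) (auto intro!: continuous_intros)
  have lam1_cont: "continuous_on {0..T} lam1"
    using continuous_on_min_eigenvalue[OF H_cont sym] by (rule continuous_on_eq) (simp_all add: lam1)
  have f0: "f t 0 = 0" if "t \<in> {0..T}" for t
    using that \<open>\<forall>t\<in>{0..T}. gradient (F t) 0 = 0\<close> by (simp add: f_def)
  have linearization: "\<exists>\<delta>>0. \<forall>t\<in>{0..T}. \<forall>x. norm x \<le> \<delta> \<longrightarrow> norm (f t x - H t x) \<le> \<eta> * norm x"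
    if "\<eta> > 0" for \<eta>
    using uniform_linearization_at_0[OF B(1,3) f0 that] unfolding H_def by metis
  note tstar = first_zero_of_integral[OF lam1_cont \<open>T > 0\<close> \<open>lam1 0 > 0\<close> \<open>integral {0..T} lam1 < 0\<close>,
      folded tstar_def L_def]

  \<comment> \<open>Decay of the solutions and absence of jumps before \<open>tstar\<close>\<close>
  have decay: "\<forall>\<^sub>F k in sequentially. \<forall>t\<in>{0..t0}. norm (v k t) \<le> norm (v k 0)" if "t0 < tstar" for t0
  proof -
    \<comment> \<open>One \<eta> serves two purposes: as linearization error it lowers the
      coercivity rate to \<open>lam1 t - \<eta>\<close>, and by the linear lower bound on
      \<open>L\<close> the integral of this rate is still nonnegative.\<close>
    obtain \<eta> where \<eta>: "\<eta> > 0" "\<And>t. t \<in> {0..t0} \<Longrightarrow> \<eta> * t \<le> L t"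
      using tstar(4)[OF \<open>t0 < tstar\<close>] by blast
    obtain \<delta> where \<delta>: "\<delta> > 0"
      "\<And>t x. t \<in> {0..T} \<Longrightarrow> norm x \<le> \<delta> \<Longrightarrow> norm (f t x - H t x) \<le> \<eta> * norm x"
      using linearization[OF \<eta>(1)] by blast
    have "\<forall>\<^sub>F k in sequentially. norm (v k 0) < \<delta>"
      using tendsto_norm[OF v0] \<delta>(1) by (intro order_tendstoD(2)) auto
    then show ?thesis
    proof eventually_elim
      case (elim k)
      show ?case
      proof
        fix t assume t: "t \<in> {0..t0}"
        show "norm (v k t) \<le> norm (v k 0)"
          using \<epsilon>'[of k] _ sol[of _ k] _ _ _ elim t
        proof (rule decay_of_small_solutions[where m = "\<lambda>t. lam1 t - \<eta>"])
          show "t0 \<le> T"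
            using \<open>t0 < tstar\<close> tstar(2) by simp
          show "continuous_on {0..T} (\<lambda>t. lam1 t - \<eta>)"
            by (intro continuous_intros lam1_cont)
          fix t assume t: "t \<in> {0..t0}"
          then have tT: "t \<in> {0..T}"
            using \<open>t0 < tstar\<close> tstar(2) by simp
          have "lam1 integrable_on {0..t}"
            using tT by (intro integrable_continuous_real continuous_on_subset[OF lam1_cont]) auto
          then show "0 \<le> integral {0..t} (\<lambda>t. lam1 t - \<eta>)"
            using \<eta>(2)[OF t] t by (subst integral_diff) (auto simp: L_def mult.commute)
          fix x :: 'a assume x: "norm x \<le> \<delta>"
          have "lam1 t * (norm x)\<^sup>2 \<le> H t x \<bullet> x"
            using min_eigenvalue_self_adjoint(1)[OF lin_H sym[OF tT], of x] lam1[OF tT] by simp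
          moreover have "\<bar>x \<bullet> (f t x - H t x)\<bar> \<le> norm x * (\<eta> * norm x)"
            using \<delta>(2)[OF tT x] by (intro order_trans[OF Cauchy_Schwarz_ineq2] mult_left_mono) auto
          ultimately show "(lam1 t - \<eta>) * (norm x)\<^sup>2 \<le> x \<bullet> f t x"
            by (simp add: inner_diff_right algebra_simps power2_eq_square inner_commute abs_le_iff)
        qed
      qed
    qed
  qed

  have u_before: "u t = 0" if "t \<in> {0..<tstar}" for t
  proof -
    obtain t0 where t0: "t < t0" "t0 < tstar"
      using \<open>t \<in> {0..<tstar}\<close> dense by auto
    have "\<forall>\<^sub>F k in sequentially. norm (v k t) \<le> norm (v k 0)"
      using decay[OF t0(2)] by (rule eventually_mono) (use that t0 in auto)
    then have "(\<lambda>k. v k t) \<longlonglongrightarrow> 0"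
      by (rule Lim_null_comparison) (use tendsto_norm[OF v0] in simp)
    moreover have "(\<lambda>k. v k t) \<longlonglongrightarrow> u t"
      using that tstar(2) by (intro v_lim) auto
    ultimately show ?thesis
      by (rule LIMSEQ_unique[symmetric])
  qed
  have "tstar \<le> t" if "t \<in> jump_set T u" for t
  proof (rule ccontr)
    assume "\<not> tstar \<le> t"
    then have "t \<in> {0..<tstar}"
      using that by (simp add: jump_set_def)
    have "\<forall>\<^sub>F s in at t within {0..T}. s < tstar"
      using \<open>\<not> tstar \<le> t\<close> by (intro order_tendstoD(2)[OF tendsto_ident_at]) simp
    moreover have "\<forall>\<^sub>F s in at t within {0..T}. s \<in> {0..T}"
      by (simp add: eventually_at_filter)
    ultimately have "\<forall>\<^sub>F s in at t within {0..T}. u s = u t"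
      by eventually_elim (use u_before \<open>t \<in> {0..<tstar}\<close> in auto)
    then have "continuous (at t within {0..T}) u"
      unfolding continuous_within by (rule tendsto_eventually)
    with that show False
      by (simp add: jump_set_def)
  qed

  \<comment> \<open>Consequences of continuity at \<open>tstar\<close> and choice of
    constants\<close>
  moreover have "tstar \<in> jump_set T u"
  proof (rule ccontr)
    assume "tstar \<notin> jump_set T u"
    then have u_cont: "(u \<longlongrightarrow> u tstar) (at tstar within {0..T})"
      using tstar(1,2) by (simp add: jump_set_def continuous_within)
    then have "(u \<longlongrightarrow> u tstar) (at tstar)"
      using tstar(1,2) by (simp add: at_within_Icc_at)
    moreover have "\<forall>\<^sub>F t in at_left tstar. 0 < t \<and> t < tstar"
      using eventually_at_left_real[OF tstar(1)] by simp
    then have "\<forall>\<^sub>F t in at_left tstar. u t = 0"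
      by eventually_elim (simp add: u_before)
    then have "(u \<longlongrightarrow> 0) (at_left tstar)"
      by (rule tendsto_eventually)
    ultimately have u_tstar: "u tstar = 0"
      by (metis filterlim_at_split tendsto_unique trivial_limit_at_left_real)

    obtain \<rho> where \<rho>: "\<rho> > 0" "{0..tstar + \<rho>} \<subseteq> {0..T}"
      "\<And>t. t \<in> {0..tstar + \<rho>} \<Longrightarrow> dim (span {e1}) = 1"
      "\<And>t. t \<in> {0..tstar + \<rho>} \<Longrightarrow> eigenspace (A t) (lam1 t) = span {e1}"
      using A1 unfolding simple_eigenvalue_def by metis
    define b where "b = tstar + \<rho>"
    have bT: "{0..b} \<subseteq> {0..T}"
      using \<rho> by (simp add: b_def)
    have "e1 \<noteq> 0"
      using \<rho>(3)[of 0] \<rho>(1) tstar(1) by auto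
    define e where "e = e1 /\<^sub>R norm e1"
    have e: "norm e = 1"
      using \<open>e1 \<noteq> 0\<close> by (simp add: e_def)
    have "span {e} = span {e1}"
      using \<open>e1 \<noteq> 0\<close> unfolding e_def by (intro span_image_scale[of "{e1}" "\<lambda>_. inverse (norm e1)", simplified])
    then have eigenspace: "eigenspace (H t) (min_eigenvalue (H t)) = span {e}" if "t \<in> {0..b}" for t
      using \<rho>(4)[of t] that AH lam1 bT by (simp add: b_def subset_iff)
    then have He: "H t e = lam1 t *\<^sub>R e" if "t \<in> {0..b}" for t
      using that span_base[of e "{e}"] lam1 bT by (auto simp: eigenspace_def subset_iff)
    obtain g where g: "g > 0"
      "\<And>t y. t \<in> {0..b} \<Longrightarrow> y \<bullet> e = 0 \<Longrightarrow> (min_eigenvalue (H t) + g) * (norm y)\<^sup>2 \<le> H t y \<bullet> y"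
      using uniform_spectral_gap[OF continuous_on_subset[OF H_cont bT] sym eigenspace] bT by blast

    have tstar_interior: "tstar \<in> {0<..<T}"
      using tstar(1,2) by simp
    have tstarT: "tstar \<in> {0..T}" "tstar \<in> {0..b}"
      using tstar(1,2) \<rho>(1) by (auto simp: b_def)
    have nondegenerate: "x = 0" if "H tstar x = 0" for x
      using det_op_nonzero_imp_injective[OF lin_H, of tstar x] A2 AH[OF tstarT(1)] that by simp
    have L_deriv: "(L has_real_derivative lam1 tstar) (at tstar)"
      using integral_has_real_derivative[OF lam1_cont tstarT(1)] tstar(1,2)
      by (simp add: at_within_Icc_at L_def[abs_def])
    \<comment> \<open>By (A2) the derivative of \<open>L\<close> at \<open>tstar\<close> is nonzero;
      as \<open>L\<close> is positive just before its zero \<open>tstar\<close>, it must be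
      negative. So \<open>L\<close> is negative right after \<open>tstar\<close>.\<close>
    have "lam1 tstar \<noteq> 0"
      using nondegenerate[of e] He[OF tstarT(2)] e by auto
    moreover have "\<not> lam1 tstar > 0"
    proof
      assume "lam1 tstar > 0"
      then obtain d where d: "d > 0" "\<And>h. 0 < h \<Longrightarrow> h < d \<Longrightarrow> L (tstar - h) < L tstar"
        using DERIV_pos_inc_left[OF L_deriv] by blast
      define h where "h = min d tstar / 2"
      have h: "0 < h" "h < d" "h < tstar"
        using d tstar(1) by (auto simp: h_def)
      obtain \<eta> where "\<eta> > 0" "\<eta> * (tstar - h) \<le> L (tstar - h)"
        using tstar(4)[of "tstar - h"] h by force
      moreover have "\<eta> * (tstar - h) > 0"
        using \<open>\<eta> > 0\<close> h by simp
      ultimately show False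
        using d(2)[OF h(1,2)] tstar(3) by linarith
    qed
    ultimately have "lam1 tstar < 0"
      by simp
    then obtain d1 where d1: "d1 > 0" "\<And>h. 0 < h \<Longrightarrow> h < d1 \<Longrightarrow> L (tstar + h) < 0"
      using DERIV_neg_dec_right[OF L_deriv] tstar(3) by auto
    obtain c \<delta>0 \<sigma>0 where c: "c > 0" "\<delta>0 > 0" "\<sigma>0 > 0" "{tstar - \<sigma>0..tstar + \<sigma>0} \<subseteq> {0..T}"
      "\<And>t x. t \<in> {tstar - \<sigma>0..tstar + \<sigma>0} \<Longrightarrow> norm x \<le> \<delta>0 \<Longrightarrow> c * norm x \<le> norm (f t x)"
      using norm_lower_bound_near_nondegenerate[OF H_cont tstar_interior nondegenerate linearization] by blast
    have "\<forall>\<^sub>F t in at tstar within {0..T}. norm (u t) < \<delta>0"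
      using tendsto_norm[OF u_cont] u_tstar c(2) by (intro order_tendstoD(2)) auto
    then obtain d2 where d2: "d2 > 0"
      "\<And>t. t \<in> {0..T} \<Longrightarrow> t \<noteq> tstar \<Longrightarrow> dist t tstar < d2 \<Longrightarrow> norm (u t) < \<delta>0"
      by (auto simp: eventually_at)
    \<comment> \<open>Within this distance of \<open>tstar\<close> four things hold: the lower bound
      on \<open>f\<close> (\<open>\<sigma>0\<close>), the spectral assumption (\<rho>), negativity
      of \<open>L\<close> to the right (\<open>d1\<close>), and smallness of \<open>u\<close>
      (\<open>d2\<close>).\<close>
    define \<sigma> where "\<sigma> = min (min \<sigma>0 \<rho>) (min d1 d2)"
    define I where "I = {tstar - \<sigma><..<tstar + \<sigma>}"
    have \<sigma>: "\<sigma> > 0" "\<sigma> \<le> \<sigma>0" "\<sigma> \<le> \<rho>" "\<sigma> \<le> d1" "\<sigma> \<le> d2"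
      using c d1 d2 \<rho> by (auto simp: \<sigma>_def)
    have I: "I \<subseteq> {tstar - \<sigma>0..tstar + \<sigma>0}" "I \<subseteq> {0..T}"
      using \<sigma> c(4) by (auto simp: I_def)
    \<comment> \<open>At a continuity point \<open>u t\<close> is critical, and by the lower bound
      on \<open>f\<close> the only critical point of norm at most \<open>\<delta>0\<close> is
      0.\<close>
    have u_zero: "u t = 0" if "t \<in> I" "t \<notin> jump_set T u" for t
    proof (cases "t = tstar")
      case False
      have "f t (u t) = 0"
        using that I \<open>limit_evolution T F u\<close> by (auto simp: limit_evolution_def f_def)
      moreover have "norm (u t) \<le> \<delta>0"
        using d2(2)[of t] that I \<sigma> False by (auto simp: I_def dist_real_def abs_less_iff less_imp_le)
      then have "c * norm (u t) \<le> norm (f t (u t))"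
        using that I by (intro c(5)) auto
      ultimately show ?thesis
        using c(1) by (simp add: mult_le_0_iff)
    qed (simp add: u_tstar)
    have regular_point: "\<exists>t\<in>{a<..<b'}. t \<notin> jump_set T u" if "a < b'" for a b'
    proof -
      have "\<not> {a<..<b'} \<subseteq> jump_set T u"
        using \<open>limit_evolution T F u\<close> that uncountable_open_interval[of a b'] countable_subset
        by (auto simp: limit_evolution_def)
      then show ?thesis
        by blast
    qed
    obtain t1 where t1: "tstar < t1" "t1 < tstar + \<sigma>"
      using \<sigma>(1) dense[of tstar "tstar + \<sigma>"] by auto
    have "L t1 < 0"
      using d1(2)[of "t1 - tstar"] t1 \<sigma> by simp
    obtain t0 where t0: "tstar - \<sigma> < t0" "0 \<le> t0" "t0 < tstar"
      using dense[of "max 0 (tstar - \<sigma>)" tstar] tstar(1) \<sigma>(1) by auto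
    have "t1 > 0" "{0..t1} \<subseteq> {0..b}" "t1 \<le> T"
      using t1 \<sigma> tstar(1) bT by (auto simp: b_def)

    obtain c2 where c2: "c2 > 0" "\<forall>\<^sub>F k in sequentially. c2 < \<bar>v k 0 \<bullet> e1\<bar>\<^sup>2 / (norm (v k 0))\<^sup>2"
      using liminf_positive_subseq_bound[OF assms(19) \<open>strict_mono r\<close>] unfolding v_def by blast
    \<comment> \<open>The factor \<open>(norm e1)\<^sup>2\<close> accounts for passing from
      \<open>e1\<close> to the unit vector \<open>e\<close>; the maximum with 2 is what cone
      invariance requires.\<close>
    define K where "K = max 2 ((norm e1)\<^sup>2 / c2)"
    have cone: "\<forall>\<^sub>F k in sequentially. (norm (v k 0))\<^sup>2 \<le> K * (v k 0 \<bullet> e)\<^sup>2"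
      using c2(2)
    proof eventually_elim
      case (elim k)
      \<comment> \<open>At 0 the quotient would be 0 by the convention for division by zero, which
        does not exceed \<open>c2\<close>.\<close>
      then have "v k 0 \<noteq> 0"
        using c2(1) by auto
      then have "c2 * (norm (v k 0))\<^sup>2 < (v k 0 \<bullet> e1)\<^sup>2"
        using elim by (simp add: field_simps)
      then have "(norm (v k 0))\<^sup>2 \<le> (norm e1)\<^sup>2 / c2 * (v k 0 \<bullet> e)\<^sup>2"
        using c2(1) \<open>e1 \<noteq> 0\<close> by (simp add: e_def field_simps)
      also have "\<dots> \<le> K * (v k 0 \<bullet> e)\<^sup>2"
        by (intro mult_right_mono) (auto simp: K_def)
      finally show ?case .
    qed
    have "K \<ge> 2"
      by (simp add: K_def)
    \<comment> \<open>The first bound lets the spectral gap dominate the remainder. The second gives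
      \<open>K * \<eta> * t1 \<le> - L t1 / 2\<close>, so the exponent in the growth estimate stays
      negative.\<close>
    define \<eta> where "\<eta> = min (g / (2 * (1 + K))) (- L t1 / (2 * K * t1))"
    have \<eta>: "\<eta> > 0" "2 * (1 + K) * \<eta> \<le> g" "L t1 + K * \<eta> * t1 < 0"
    proof -
      show "\<eta> > 0"
        using g(1) \<open>K \<ge> 2\<close> \<open>t1 > 0\<close> \<open>L t1 < 0\<close> by (simp add: \<eta>_def divide_neg_pos)
      have "\<eta> \<le> g / (2 * (1 + K))" "\<eta> \<le> - L t1 / (2 * K * t1)"
        unfolding \<eta>_def by (rule min.cobounded1, rule min.cobounded2)
      then have "2 * (1 + K) * \<eta> \<le> g" "2 * (K * \<eta> * t1) \<le> - L t1"
        using \<open>K \<ge> 2\<close> \<open>t1 > 0\<close> by (simp_all add: field_simps)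
      then show "2 * (1 + K) * \<eta> \<le> g" "L t1 + K * \<eta> * t1 < 0"
        using \<open>L t1 < 0\<close> by auto
    qed
    obtain \<delta>1 where \<delta>1: "\<delta>1 > 0"
      "\<And>t x. t \<in> {0..T} \<Longrightarrow> norm x \<le> \<delta>1 \<Longrightarrow> norm (f t x - H t x) \<le> \<eta> * norm x"
      using linearization[OF \<eta>(1)] by blast
    define \<delta> where "\<delta> = min \<delta>0 \<delta>1"
    have \<delta>: "\<delta> > 0" "\<delta> \<le> \<delta>0" "\<delta> \<le> \<delta>1"
      using c(2) \<delta>1(1) by (auto simp: \<delta>_def)

    \<comment> \<open>Uniform smallness of the solutions across \<open>tstar\<close>\<close>
    have "\<forall>\<^sub>F k in sequentially. \<forall>t\<in>{t0..t1}. norm (v k t) \<le> \<delta>"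
    proof -
      obtain \<kappa> G where G: "\<kappa> > 0" "continuous_on ({0..T} \<times> UNIV) (\<lambda>(t, x). G t x)"
        "\<And>\<epsilon> u t. \<epsilon> > 0 \<Longrightarrow> t \<in> {0..T} \<Longrightarrow>
          (u has_vector_derivative (- (1 / \<epsilon>)) *\<^sub>R f t (u t)) (at t within {0..T}) \<Longrightarrow>
          \<exists>h'. ((\<lambda>s. G s (u s)) has_real_derivative h') (at t within {0..T}) \<and>
            h' \<le> - (\<kappa> / \<epsilon>) * (norm (f t (u t)))\<^sup>2"
        by (fact energy_dissipation[OF \<open>F0 T F\<close> \<open>F2 T F\<close> \<open>T > 0\<close>, folded f_def])
      have "t0 \<le> t1"
        using t0 t1 by simp
      then show ?thesis
      \<comment> \<open>The bound passes to unions of adjacent intervals, so it suffices to prove it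
        on short intervals around each point \<open>x\<close>. Only finitely many eventual
        statements get combined.\<close>
      proof (induction t0 t1 rule: Bolzano)
        case (trans a b c)
        from trans(1,2) show ?case
          by eventually_elim (meson atLeastAtMost_iff linear)
      next
        case (local x)
        then have "x \<in> I"
          using t0 t1 by (simp add: I_def)
        \<comment> \<open>The energy price of an excursion to radius \<delta>. On the interval
          chosen next, \<open>G t 0\<close> stays within \<open>\<gamma> / 2\<close> of
          \<open>G x 0\<close>, so its end values differ by less than \<gamma>.\<close>
        define \<gamma> where "\<gamma> = \<kappa> * c / 2 * \<delta>\<^sup>2"
        have "\<gamma> > 0"
          using G(1) c(1) \<delta>(1) by (simp add: \<gamma>_def)
        have "continuous_on {0..T} (\<lambda>t. case (t, 0) of (t, x) \<Rightarrow> G t x)"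
          by (rule continuous_on_compose2[OF G(2)]) (auto intro!: continuous_intros)
        then have "continuous_on {0..T} (\<lambda>t. G t 0)"
          by simp
        then obtain d where d: "d > 0" "\<And>t. t \<in> {0..T} \<Longrightarrow> dist t x < d \<Longrightarrow> dist (G t 0) (G x 0) < \<gamma> / 2"
          using \<open>x \<in> I\<close> I(2) \<open>\<gamma> > 0\<close> unfolding continuous_on_iff by (metis half_gt_zero subsetD)
        \<comment> \<open>Both endpoints avoid the countable jump set, so \<open>u\<close> vanishes
          there and the energies of \<open>v k\<close> at the endpoints converge to
          \<open>G a 0\<close> and \<open>G b' 0\<close>.\<close>
        obtain a where a: "x - d < a" "a < x" "a \<in> I" "a \<notin> jump_set T u"
          using regular_point[of "max (x - d) (tstar - \<sigma>)" x] d(1) \<open>x \<in> I\<close> by (auto simp: I_def)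
        obtain b' where b': "x < b'" "b' < x + d" "b' \<in> I" "b' \<notin> jump_set T u"
          using regular_point[of x "min (x + d) (tstar + \<sigma>)"] d(1) \<open>x \<in> I\<close> by (auto simp: I_def)
        have abT: "a \<in> {0..T}" "b' \<in> {0..T}"
          using a b' I(2) by auto
        have ab: "{a..b'} \<subseteq> I"
          using a b' by (auto simp: I_def)
        have "dist (G a 0) (G x 0) < \<gamma> / 2" "dist (G b' 0) (G x 0) < \<gamma> / 2"
          using a b' by (intro d(2) abT; simp add: dist_real_def)+
        then have gap: "G a 0 + \<kappa> * c / 2 * (norm (0::'a))\<^sup>2 < G b' 0 + \<kappa> * c / 2 * \<delta>\<^sup>2"
          unfolding \<gamma>_def[symmetric] dist_real_def by simp argo
        have lim: "(\<lambda>k. v k t) \<longlonglongrightarrow> 0" "(\<lambda>k. G t (v k t)) \<longlonglongrightarrow> G t 0"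
          if "t \<in> I" "t \<notin> jump_set T u" for t
        proof -
          have t: "t \<in> {0..T}"
            using that I by auto
          show v: "(\<lambda>k. v k t) \<longlonglongrightarrow> 0"
            using v_lim[OF t] u_zero[OF that] by simp
          have "continuous_on UNIV (\<lambda>x. case (t, x) of (t, x) \<Rightarrow> G t x)"
            by (rule continuous_on_compose2[OF G(2)]) (use t in \<open>auto intro!: continuous_intros\<close>)
          then have "continuous_on UNIV (\<lambda>x. G t x)"
            by simp
          then show "(\<lambda>k. G t (v k t)) \<longlonglongrightarrow> G t 0"
            by (rule continuous_on_tendsto_compose[OF _ v]) auto
        qed
        have "(\<lambda>k. G a (v k a) + \<kappa> * c / 2 * (norm (v k a))\<^sup>2 - G b' (v k b')) \<longlonglongrightarrow>
            G a 0 + \<kappa> * c / 2 * (norm (0::'a))\<^sup>2 - G b' 0"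
          by (intro tendsto_intros lim a b')
        then have "\<forall>\<^sub>F k in sequentially. G a (v k a) + \<kappa> * c / 2 * (norm (v k a))\<^sup>2 - G b' (v k b') < \<kappa> * c / 2 * \<delta>\<^sup>2"
          by (rule order_tendstoD(2)) (use gap in linarith)
        moreover have "\<forall>\<^sub>F k in sequentially. norm (v k a) < \<delta>"
          using tendsto_norm[OF lim(1)[OF a(3,4)]] \<delta>(1) by (intro order_tendstoD(2)) auto
        ultimately have near: "\<forall>\<^sub>F k in sequentially. \<forall>t\<in>{a..b'}. norm (v k t) < \<delta>"
        proof eventually_elim
          case (elim k)
          have "\<forall>t\<in>{0..T}. \<exists>h'. ((\<lambda>s. G s (v k s)) has_real_derivative h') (at t within {0..T}) \<and>
              h' \<le> - (\<kappa> / \<epsilon>' k) * (norm (f t (v k t)))\<^sup>2"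
            using G(3)[OF \<epsilon>' _ sol] by blast
          then obtain h' where h': "\<And>t. t \<in> {0..T} \<Longrightarrow> ((\<lambda>s. G s (v k s)) has_real_derivative h' t) (at t within {0..T})"
              "\<And>t. t \<in> {0..T} \<Longrightarrow> h' t \<le> - (\<kappa> / \<epsilon>' k) * (norm (f t (v k t)))\<^sup>2"
            by metis
          show ?case
          proof
            fix t assume "t \<in> {a..b'}"
            with \<epsilon>' G(1) c(1) _ sol h' _ elim(2) _ show "norm (v k t) < \<delta>"
            proof (rule energy_confines_solution)
              show "{a..b'} \<subseteq> {0..T}"
                using ab I(2) by blast
              show "G a (v k a) + \<kappa> * c / 2 * (norm (v k a))\<^sup>2 < G b' (v k b') + \<kappa> * c / 2 * \<delta>\<^sup>2"
                using elim(1) by linarith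
            qed (use ab I(1) \<delta>(2) in \<open>auto intro!: c(5)\<close>)
          qed
        qed
        \<comment> \<open>An interval that contains \<open>x\<close> and is shorter than both
          \<open>x - a\<close> and \<open>b' - x\<close> lies in \<open>{a..b'}\<close>.\<close>
        have "\<forall>\<^sub>F k in sequentially. \<forall>t\<in>{a'..b''}. norm (v k t) \<le> \<delta>"
          if "a' \<le> x \<and> x \<le> b'' \<and> b'' - a' < min (x - a) (b' - x)" for a' b''
          using near
        proof eventually_elim
          case (elim k)
          have "{a'..b''} \<subseteq> {a..b'}"
            using that by auto
          with elim show ?case
            by (auto intro: less_imp_le)
        qed
        then show ?case
          using a b' by (intro exI[of _ "min (x - a) (b' - x)"]) auto
      qed
    qed
    moreover have "\<forall>\<^sub>F k in sequentially. norm (v k 0) < \<delta>"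
      using tendsto_norm[OF v0] \<delta>(1) by (intro order_tendstoD(2)) auto
    moreover note decay[OF t0(3)]
    ultimately have small: "\<forall>\<^sub>F k in sequentially. \<forall>t\<in>{0..t1}. norm (v k t) \<le> \<delta>"
    proof eventually_elim
      case (elim k)
      show ?case
      proof
        fix t assume "t \<in> {0..t1}"
        then show "norm (v k t) \<le> \<delta>"
          using elim by (cases "t \<le> t0") force+
      qed
    qed

    \<comment> \<open>Exponential growth against the power bound on the initial data\<close>
    define \<mu> where "\<mu> = - 2 * (L t1 + K * \<eta> * t1)"
    have "\<mu> > 0"
      using \<eta>(3) by (simp add: \<mu>_def)
    have growth: "\<forall>\<^sub>F k in sequentially. (v k 0 \<bullet> e)\<^sup>2 \<le> \<delta>\<^sup>2 * exp (- \<mu> / \<epsilon>' k)"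
      using small cone
    proof eventually_elim
      case (elim k)
      have "(v k 0 \<bullet> e)\<^sup>2 \<le> \<delta>\<^sup>2 * exp (2 / \<epsilon>' k * (integral {0..t1} lam1 + K * \<eta> * t1))"
        using \<epsilon>' \<open>t1 \<le> T\<close> _ e sol lam1_cont lin_H
      proof (rule growth_along_eigenvector[where g = g])
        fix t assume "t \<in> {0..t1}"
        then have t: "t \<in> {0..b}" "t \<in> {0..T}"
          using \<open>{0..t1} \<subseteq> {0..b}\<close> bT by auto
        show "H t x \<bullet> y = H t y \<bullet> x" for x y
          using t(2) by (rule sym)
        show "H t e = lam1 t *\<^sub>R e"
          using t(1) by (rule He)
        show "(lam1 t + g) * (norm y)\<^sup>2 \<le> H t y \<bullet> y" if "y \<bullet> e = 0" for y
          using g(2)[OF t(1) that] lam1[OF t(2)] by simp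
        show "norm (f t x - H t x) \<le> \<eta> * norm x" if "norm x \<le> \<delta>" for x
          using that \<delta>(3) by (intro \<delta>1(2)[OF t(2)]) simp
        show "norm (v k t) \<le> \<delta>"
          using elim \<open>t \<in> {0..t1}\<close> by blast
      qed (use elim \<eta> \<open>K \<ge> 2\<close> \<open>t1 > 0\<close> in auto)
      also have "2 / \<epsilon>' k * (integral {0..t1} lam1 + K * \<eta> * t1) = - \<mu> / \<epsilon>' k"
        by (simp add: \<mu>_def L_def)
      finally show ?case .
    qed

    obtain \<alpha> where "0 < liminf (\<lambda>k. ereal (norm (u\<epsilon> k 0) / \<epsilon> k powr \<alpha>))"
      using assms(18) by blast
    from liminf_positive_subseq_bound[OF this \<open>strict_mono r\<close>]
    obtain c3 where c3: "c3 > 0" "\<forall>\<^sub>F k in sequentially. c3 < norm (v k 0) / \<epsilon>' k powr \<alpha>"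
      unfolding v_def \<epsilon>'_def by blast
    \<comment> \<open>The squared initial norm is bounded below by a power of \<epsilon> and,
      through the cone condition and the growth estimate, above by an exponentially small
      quantity.\<close>
    have "\<forall>\<^sub>F k in sequentially. c3\<^sup>2 * \<epsilon>' k powr (2 * \<alpha>) \<le> K * \<delta>\<^sup>2 * exp (- \<mu> / \<epsilon>' k)"
      using c3(2) growth cone
    proof eventually_elim
      case (elim k)
      have "c3 * \<epsilon>' k powr \<alpha> \<le> norm (v k 0)"
        using elim(1) \<epsilon>'[of k] by (simp add: field_simps)
      then have "(c3 * \<epsilon>' k powr \<alpha>)\<^sup>2 \<le> (norm (v k 0))\<^sup>2"
        using c3(1) by (intro power_mono) auto
      also have "\<dots> \<le> K * (v k 0 \<bullet> e)\<^sup>2"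
        by (fact elim(3))
      also have "\<dots> \<le> K * (\<delta>\<^sup>2 * exp (- \<mu> / \<epsilon>' k))"
        using elim(2) \<open>K \<ge> 2\<close> by (intro mult_left_mono) auto
      also have "(c3 * \<epsilon>' k powr \<alpha>)\<^sup>2 = c3\<^sup>2 * \<epsilon>' k powr (2 * \<alpha>)"
        unfolding mult_2 powr_add power2_eq_square by (simp only: mult_ac)
      finally show ?case
        by (simp add: mult.assoc)
    qed
    then show False
      using powr_not_eventually_le_exp_inverse[OF \<epsilon>' \<epsilon>'_lim \<open>\<mu> > 0\<close>, of "c3\<^sup>2"] c3(1) by simp
  qed
  ultimately show ?thesis
    by blast
qed

end
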